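(* In the spatiotemporal E-GARCH model, assume $\mathbf{I}-\lambda_0\mathbf{W}_2$ is invertible, $\varrho(\lambda_1\mathbf{S})<1$, $\varrho(\lambda_0\mathbf{W}_2)<1$, and $\{\boldsymbol{\varepsilon}_t\}$ i.i.d. $N(\mathbf{0},\mathbf{I}_n)$; let $\boldsymbol{Y}_t$ be the stationary solution. Define (componentwise $\ln$ and squares) $$\boldsymbol{\nu}_t=\ln\boldsymbol{Y}_t^2-\lambda_1\mathbf{S}\ln\boldsymbol{Y}_{t-1}^2 .$$ Then $\ln\boldsymbol{Y}_t^2=\lambda_1\mathbf{S}\ln\boldsymbol{Y}_{t-1}^2+\boldsymbol{\nu}_t$, and $$\boldsymbol{\nu}_t=\mathbf{S}\big(\boldsymbol{\alpha}_1+\rho_0\mathbf{W}_1g(\boldsymbol{\varepsilon}_t)+\rho_1g(\boldsymbol{\varepsilon}_{t-1})-\lambda_1\ln\boldsymbol{\varepsilon}_{t-1}^2\big)+\ln\boldsymbol{\varepsilon}_t^2=\boldsymbol{\Delta}_t-\lambda_1\mathbf{S}\ln\boldsymbol{\varepsilon}_{t-1}^2+\ln\boldsymbol{\varepsilon}_t^2 .$$ Moreover, with $c_g=\Theta^2+\xi^2(1-2/\pi)$ and $\kappa=2\xi\ln(2)\sqrt{2/\pi}$: (a) $E(\boldsymbol{\nu}_t)=\mathbf{S}\boldsymbol{\alpha}_1+(-\ln 2-\gamma)(\mathbf{I}-\lambda_1\mathbf{S})\mathbf{1}$, where $\gamma$ is the Euler–Mascheroni constant and $\mathbf{1}$ the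 all-ones vector; if moreover $\mathbf{W}_2$ is row-standardised (rows sum to one) then $E(\boldsymbol{\nu}_t)=\mathbf{S}\boldsymbol{\alpha}_1+(-\ln2-\gamma)\big(1-\frac{\lambda_1}{1-\lambda_0}\big)\mathbf{1}$. (b) $\operatorname{Cov}(\boldsymbol{\nu}_t)=\rho_0^2c_g\,\mathbf{S}\mathbf{W}_1\mathbf{W}_1'\mathbf{S}'+\frac{\pi^2}{2}\mathbf{I}+\rho_0\kappa\big(\mathbf{S}\mathbf{W}_1+\mathbf{W}_1'\mathbf{S}'\big)+\Big(\rho_1^2c_g+\lambda_1^2\frac{\pi^2}{2}-2\rho_1\lambda_1\kappa\Big)\mathbf{S}\mathbf{S}'$. (c) $\operatorname{Cov}(\boldsymbol{\nu}_t,\boldsymbol{\nu}_{t-1})=E\big[(\boldsymbol{\nu}_t-E\boldsymbol{\nu}_t)(\boldsymbol{\nu}_{t-1}-E\boldsymbol{\nu}_{t-1})'\big]=\big(\rho_0\rho_1c_g-\lambda_1\rho_0\kappa\big)\mathbf{S}\mathbf{W}_1'\mathbf{S}'+\Big(\rho_1\kappa-\lambda_1\frac{\pi^2}{2}\Big)\mathbf{S}$. (d) $\operatorname{Cov}(\boldsymbol{\nu}_t,\boldsymbol{\nu}_{t-s})=\mathbf{0}$ for all $s>1$.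
   Context: Fix $n\ge1$ and known deterministic real $n\times n$ matrices $\mathbf{W}_1,\mathbf{W}_2$; parameters $\boldsymbol{\alpha}_1\in\mathbb{R}^n$, $\rho_0,\rho_1,\lambda_0,\lambda_1,\Theta\in\mathbb{R}$, $\xi\ge0$ (standing assumption $|\Theta|<\xi$). Componentwise $g(\boldsymbol{\varepsilon}_t)=\Theta\boldsymbol{\varepsilon}_t+\xi(|\boldsymbol{\varepsilon}_t|-E|\boldsymbol{\varepsilon}_t|)$ (for standard normal entries $E|\varepsilon_t(\boldsymbol{s}_i)|=\sqrt{2/\pi}$). Model: $Y_t(\boldsymbol{s}_i)=\sqrt{h_t(\boldsymbol{s}_i)}\,\varepsilon_t(\boldsymbol{s}_i)$ with $\ln\boldsymbol{h}_t=\boldsymbol{\alpha}_1+\rho_0\mathbf{W}_1g(\boldsymbol{\varepsilon}_t)+\rho_1 g(\boldsymbol{\varepsilon}_{t-1})+\lambda_0\mathbf{W}_2\ln\boldsymbol{h}_t+\lambda_1\ln\boldsymbol{h}_{t-1}$. $\mathbf{S}=(\mathbf{I}-\lambda_0\mathbf{W}_2)^{-1}$, $\boldsymbol{\Delta}_t=\mathbf{S}(\boldsymbol{\alpha}_1+\rho_0\mathbf{W}_1g(\boldsymbol{\varepsilon}_t)+\rho_1g(\boldsymbol{\varepsilon}_{t-1}))$; the stationary solution is $\boldsymbol{Y}_t=\boldsymbol{\varepsilon}_t\odot\exp\big(\tfrac12\sum_{v\ge0}\lambda_1^v\mathbf{S}^v\boldsymbol{\Delta}_{t-v}\big)$. $\varrho(\cdot)$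 is spectral radius. *)

theory Defs
  imports "HOL-Probability.Probability"
begin

text \<open>Componentwise E-GARCH news-impact function
  g(x) = Theta x + xi (|x| - E|eps|), with E|eps| = sqrt(2/pi) for standard normal eps.\<close>
definition egarch_g :: "real \<Rightarrow> real \<Rightarrow> real^'n \<Rightarrow> real^'n" where
  "egarch_g \<Theta> \<xi> x = (\<chi> i. \<Theta> * x$i + \<xi> * (\<bar>x$i\<bar> - sqrt (2 / pi)))"

text \<open>Matrix powers (real^'n^'n carries the componentwise product, so we define them).\<close>
fun matpow :: "real^'n^'n \<Rightarrow> nat \<Rightarrow> real^'n^'n" where
  "matpow A 0 = mat 1"
| "matpow A (Suc k) = A ** matpow A k"

definition spectral_radius :: "real^'n^'n \<Rightarrow> real" where
  "spectral_radius A = Max {norm z | z :: complex.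
      \<exists>v :: complex^'n. v \<noteq> 0 \<and> (\<chi> i j. complex_of_real (A$i$j)) *v v = z *s v}"

definition vln_sq :: "real^'n \<Rightarrow> real^'n" where
  "vln_sq x = (\<chi> i. ln ((x$i)\<^sup>2))"

definition vcov :: "'a measure \<Rightarrow> ('a \<Rightarrow> real^'n) \<Rightarrow> ('a \<Rightarrow> real^'m) \<Rightarrow> real^'m^'n" where
  "vcov M X Z = (\<chi> i j. integral\<^sup>L M (\<lambda>\<omega>.
      (X \<omega> $ i - integral\<^sup>L M (\<lambda>\<omega>'. X \<omega>' $ i)) * (Z \<omega> $ j - integral\<^sup>L M (\<lambda>\<omega>'. Z \<omega>' $ j))))"

definition egarch_Delta ::
  "real^'n^'n \<Rightarrow> real^'n^'n \<Rightarrow> real^'n \<Rightarrow> real \<Rightarrow> real \<Rightarrow> real \<Rightarrow> real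
    \<Rightarrow> (int \<Rightarrow> 'a \<Rightarrow> real^'n) \<Rightarrow> int \<Rightarrow> 'a \<Rightarrow> real^'n" where
  "egarch_Delta S W1 \<alpha>1 \<rho>0 \<rho>1 \<Theta> \<xi> \<epsilon> t \<omega> =
     S *v (\<alpha>1 + \<rho>0 *\<^sub>R (W1 *v egarch_g \<Theta> \<xi> (\<epsilon> t \<omega>)) + \<rho>1 *\<^sub>R egarch_g \<Theta> \<xi> (\<epsilon> (t - 1) \<omega>))"

text \<open>Stationary solution Y_t = eps_t .* exp(1/2 sum_{v>=0} lambda1^v S^v Delta_{t-v}).\<close>
definition egarch_Y ::
  "real^'n^'n \<Rightarrow> real^'n^'n \<Rightarrow> real^'n \<Rightarrow> real \<Rightarrow> real \<Rightarrow> real \<Rightarrow> real \<Rightarrow> real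
    \<Rightarrow> (int \<Rightarrow> 'a \<Rightarrow> real^'n) \<Rightarrow> int \<Rightarrow> 'a \<Rightarrow> real^'n" where
  "egarch_Y S W1 \<alpha>1 \<rho>0 \<rho>1 lam1 \<Theta> \<xi> \<epsilon> t \<omega> =
     (\<chi> i. \<epsilon> t \<omega> $ i * exp (1/2 * ((\<Sum>v. (lam1 ^ v) *\<^sub>R
          (matpow S v *v egarch_Delta S W1 \<alpha>1 \<rho>0 \<rho>1 \<Theta> \<xi> \<epsilon> (t - int v) \<omega>)) $ i)))"

end

theory Submission
  imports Defs "HOL-Computational_Algebra.Fundamental_Theorem_Algebra"
begin

text \<open>
  Because the spectral radius of \<open>\<lambda>1 S\<close> is below one, its powers are summable, so the series in the
  stationary solution converges almost surely (the innovations have bounded first absolute moments).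
  Splitting off its first term gives \<open>H t = \<Delta> t + \<lambda>1 S (H (t - 1))\<close> for \<open>H t = ln h t\<close>, so the
  autoregressive residual is \<open>\<nu> t = \<mu> + P t + Q (t - 1)\<close> where \<open>P t\<close> and \<open>Q t\<close> are linear in the centred
  variables \<open>g \<epsilon>\<close> and \<open>ln \<epsilon>\<^sup>2 - E ln \<epsilon>\<^sup>2\<close> at time \<open>t\<close>. Autocovariances of this moving average only involve
  the second moments of those two variables for one standard normal variable. They come from differentiating
  \<open>E \<bar>\<epsilon>\<bar> powr (2 * s) = 2 powr s * Gamma (s + 1/2) / sqrt pi\<close>
  twice at \<open>s = 0\<close> and once at \<open>s = 1/2\<close>.
\<close>

section \<open>Powers of a matrix of spectral radius less than one\<close>

text \<open>The vector p(A) x, evaluated by Horner's scheme. Since \<open>*\<close> on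
  \<open>complex^'n^'n\<close> is componentwise, polynomials act on vectors instead of being
  evaluated at a matrix.\<close>

definition poly_act :: "complex^'n^'n \<Rightarrow> complex^'n \<Rightarrow> complex poly \<Rightarrow> complex^'n" where
  "poly_act A x p = fold_coeffs (\<lambda>a v. a *s x + A *v v) p 0"

lemma poly_act_0 [simp]: "poly_act A x 0 = 0"
  by (simp add: poly_act_def)

lemma poly_act_pCons [simp]: "poly_act A x (pCons a p) = a *s x + A *v poly_act A x p"
  by (cases "a = 0 \<and> p = 0") (auto simp: poly_act_def)

lemma poly_act_diff: "poly_act A x (p - smult z q) = poly_act A x p - z *s poly_act A x q"
proof (induction p q rule: poly_induct2)
  case (pCons a p b q)
  have "pCons a p - smult z (pCons b q) = pCons (a - z * b) (p - smult z q)" by simp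
  then show ?case
    unfolding poly_act_pCons \<open>_ = pCons _ _\<close> pCons.IH
    by (simp add: vector_sub_rdistrib matrix_vector_mult_diff_distrib vector_scalar_commute
        vector_add_ldistrib vector_smult_assoc algebra_simps)
qed auto

text \<open>q(A) commutes with \<open>A\<close>. Together with \<open>poly_act_linear_factor\<close>
  this moves a linear factor of the polynomial onto the vector: if \<open>[:- z, 1:] * q\<close>
  annihilates \<open>x\<close>, then \<open>q\<close> annihilates
  \<open>A *v x - z *s x\<close>.\<close>

lemma poly_act_comm: "poly_act A (A *v x - z *s x) q = A *v poly_act A x q - z *s poly_act A x q"
proof (induction q)
  case (pCons a q)
  show ?case
    unfolding poly_act_pCons pCons.IH
    by (simp add: vector_ssub_ldistrib matrix_vector_mult_diff_distrib vector_scalar_commute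
        vector_add_ldistrib vector_smult_assoc matrix_vector_right_distrib algebra_simps)
qed auto

lemma poly_act_linear_factor:
  "poly_act A x ([:- z, 1:] * q) = A *v poly_act A x q - z *s poly_act A x q"
proof -
  have "[:- z, 1:] * q = pCons 0 q - smult z q"
    by (simp add: mult_pCons_left algebra_simps)
  then show ?thesis by (simp add: poly_act_diff)
qed

text \<open>Horner form rewritten as a combination of the orbit of \<open>x\<close>, so that linear
  dependence of the orbit can be read as an annihilating polynomial.\<close>

lemma poly_act_sum: "poly_act A x p = (\<Sum>i\<le>degree p. coeff p i *s (((*v) A) ^^ i) x)"
proof (induction p)
  case (pCons a p)
  show ?case
  proof (cases "p = 0")
    case False
    then show ?thesis using pCons
      by (simp add: sum.atMost_Suc_shift vec.linear_sum[OF matrix_vector_mul_linear_gen]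
          vector_scalar_commute del: sum.atMost_Suc)
  qed simp
qed simp

text \<open>The n + 1 vectors x, A x, ..., A^n x lie in a space of dimension n, so they satisfy a
  nontrivial linear relation, whose coefficients are those of \<open>p\<close>. The polynomial may
  depend on \<open>x\<close>.\<close>

lemma annihilating_poly_exists:
  fixes A :: "complex^'n^'n"
  obtains p where "p \<noteq> 0" "poly_act A x p = 0"
proof -
  define f where "f i = (((*v) A) ^^ i) x" for i
  let ?N = "CARD('n)"
  have act: "poly_act A x (\<Sum>i\<le>?N. monom (c i) i) = (\<Sum>i\<le>?N. c i *s f i)" for c
  proof -
    let ?p = "\<Sum>i\<le>?N. monom (c i) i"
    have cf: "coeff ?p i = (if i \<le> ?N then c i else 0)" for i
      by (simp add: coeff_sum)
    have "degree ?p \<le> ?N" by (intro degree_le) (simp add: cf)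
    then have "(\<Sum>i\<le>degree ?p. coeff ?p i *s f i) = (\<Sum>i\<le>?N. coeff ?p i *s f i)"
      by (intro sum.mono_neutral_left) (auto simp: coeff_eq_0)
    also have "\<dots> = (\<Sum>i\<le>?N. c i *s f i)" by (intro sum.cong) (auto simp: cf)
    finally show ?thesis unfolding poly_act_sum f_def .
  qed
  have "\<exists>c. (\<exists>i\<le>?N. c i \<noteq> 0) \<and> (\<Sum>i\<le>?N. c i *s f i) = 0"
  proof (cases "inj_on f {..?N}")
    case True
    then have "card (f ` {..?N}) = Suc ?N" by (simp add: card_image)
    then have "vec.dependent (f ` {..?N})"
      using vec.dim_subset_UNIV[of "f ` {..?N}"]
      by (intro vec.dependent_biggerset_general) (simp add: vec.dimension_def card_cart_basis)
    then obtain u v where uv: "v \<in> f ` {..?N}" "u v \<noteq> 0" "(\<Sum>v\<in>f ` {..?N}. u v *s v) = 0"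
      by (auto simp: vec.dependent_finite)
    have "(\<Sum>i\<le>?N. u (f i) *s f i) = 0"
      using uv(3) by (simp add: sum.reindex[OF True])
    with uv(1,2) show ?thesis by (intro exI[of _ "\<lambda>i. u (f i)"]) auto
  next
    case False
    then obtain i j where ij: "i \<le> ?N" "j \<le> ?N" "i \<noteq> j" "f i = f j" by (auto simp: inj_on_def)
    define c :: "nat \<Rightarrow> complex" where "c k = (if k = i then 1 else if k = j then - 1 else 0)" for k
    have "(\<Sum>k\<le>?N. c k *s f k) = (\<Sum>k\<in>{i, j}. c k *s f k)"
      using ij by (intro sum.mono_neutral_right) (auto simp: c_def)
    also have "\<dots> = 0" using ij by (simp add: c_def)
    finally show ?thesis using ij by (intro exI[of _ c]) (auto simp: c_def)
  qed
  then obtain c i where c: "i \<le> ?N" "c i \<noteq> 0" "(\<Sum>i\<le>?N. c i *s f i) = 0" by blast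
  have "coeff (\<Sum>i\<le>?N. monom (c i) i) i \<noteq> 0" using c by (simp add: coeff_sum)
  then have "(\<Sum>i\<le>?N. monom (c i) i) \<noteq> 0" by auto
  then show ?thesis using that act c(3) by metis
qed

section \<open>Summability of the orbits of a complex matrix\<close>

text \<open>Summing the recursion bounds (1 - q) times every partial sum of \<open>a\<close> by
  \<open>a 0 + suminf b\<close>, and partial sums of nonnegative terms that stay bounded
  converge.\<close>

lemma summable_of_contraction:
  fixes a b :: "nat \<Rightarrow> real"
  assumes a: "\<And>k. 0 \<le> a k" and b: "summable b" "\<And>k. 0 \<le> b k" and q: "0 \<le> q" "q < 1"
    and step: "\<And>k. a (Suc k) \<le> q * a k + b k"
  shows "summable a"
proof (rule bounded_imp_summable)
  fix n
  have "(\<Sum>k\<le>n. a k) \<le> a 0 + q * (\<Sum>k\<le>n. a k) + (\<Sum>k\<le>n. b k)"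
  proof -
    have "(\<Sum>k\<le>n. a k) \<le> (\<Sum>k\<le>Suc n. a k)" using a by simp
    also have "\<dots> = a 0 + (\<Sum>k\<le>n. a (Suc k))" by (rule sum.atMost_Suc_shift)
    also have "\<dots> \<le> a 0 + (\<Sum>k\<le>n. q * a k + b k)" by (intro add_left_mono sum_mono step)
    finally show ?thesis by (simp add: sum.distrib sum_distrib_left)
  qed
  moreover have "(\<Sum>k\<le>n. b k) \<le> suminf b" using b by (intro sum_le_suminf) auto
  ultimately have "(\<Sum>k\<le>n. a k) * (1 - q) \<le> a 0 + suminf b" by (simp add: algebra_simps)
  then show "(\<Sum>k\<le>n. a k) \<le> (a 0 + suminf b) / (1 - q)" using q by (simp add: field_simps)
qed (rule a)

text \<open>
  Peel off a root \<open>z\<close> of the annihilating polynomial: if \<open>z\<close> is an eigenvalue, then \<open>y = A x - z x\<close> is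
  annihilated by the cofactor and the orbit of \<open>x\<close> contracts by \<open>norm z\<close> up to the summable orbit of
  \<open>y\<close>; otherwise \<open>A - z\<close> is injective and the cofactor already annihilates \<open>x\<close>.
\<close>
lemma summable_orbit_of_annihilated:
  fixes A :: "complex^'n^'n"
  assumes eig: "\<And>z v. v \<noteq> 0 \<Longrightarrow> A *v v = z *s v \<Longrightarrow> norm z < 1"
    and "p \<noteq> 0" "poly_act A x p = 0"
  shows "summable (\<lambda>k. norm ((((*v) A) ^^ k) x))"
  using assms(2,3)
proof (induction "degree p" arbitrary: p x)
  case 0
  then obtain a where "p = [:a:]" "a \<noteq> 0" by (metis degree_eq_zeroE pCons_0_0)
  then have "x = 0" using 0 by simp
  then have "(((*v) A) ^^ k) x = 0" for k by (induction k) auto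
  then show ?case by simp
next
  case (Suc d)
  then have "\<not> constant (poly p)" by (simp add: constant_degree)
  then obtain z where "poly p z = 0" using fundamental_theorem_of_algebra by blast
  then obtain q where pq: "p = [:- z, 1:] * q" by (metis dvdE poly_eq_0_iff_dvd)
  then have q: "q \<noteq> 0" "degree q = d"
    using Suc.prems Suc.hyps(2) by (auto simp: degree_mult_eq simp del: mult_pCons_left)
  define y where "y = A *v x - z *s x"
  have y: "poly_act A y q = 0" using Suc.prems(2) by (simp only: y_def pq poly_act_linear_factor poly_act_comm)
  have sum_y: "summable (\<lambda>k. norm ((((*v) A) ^^ k) y))" using Suc.hyps(1) q y by blast
  have iter: "(((*v) A) ^^ Suc k) x = z *s (((*v) A) ^^ k) x + (((*v) A) ^^ k) y" for k
    by (induction k) (simp_all add: y_def matrix_vector_right_distrib vector_scalar_commute)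
  show ?case
  proof (cases "\<exists>v. v \<noteq> 0 \<and> A *v v = z *s v")
    case True
    then have z: "norm z < 1" using eig by blast
    have nz: "norm (z *s v) = norm z * norm v" for v :: "complex^'n"
      by (simp add: norm_vec_def norm_mult L2_set_def
          power_mult_distrib sum_distrib_left[symmetric] real_sqrt_mult)
    have "norm ((((*v) A) ^^ Suc k) x) \<le> norm z * norm ((((*v) A) ^^ k) x) + norm ((((*v) A) ^^ k) y)" for k
      unfolding iter nz[symmetric] by (rule norm_triangle_ineq)
    then show ?thesis
      by (intro summable_of_contraction[OF _ sum_y _ _ z]) auto
  next
    case False
    have "A *v poly_act A x q - z *s poly_act A x q = 0"
      using Suc.prems(2) unfolding pq poly_act_linear_factor .
    then have "poly_act A x q = 0" using False by (metis eq_iff_diff_eq_0)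
    then show ?thesis using Suc.hyps(1) q by blast
  qed
qed

section \<open>Eigenvalues and the spectral radius\<close>

text \<open>Without finiteness the \<open>Max\<close> in \<open>spectral_radius\<close> would be a junk value.\<close>
lemma finite_eigenvalues:
  fixes A :: "complex^'n^'n"
  shows "finite {z. \<exists>v. v \<noteq> 0 \<and> A *v v = z *s v}"
proof -
  \<comment> \<open>The matrix A - X I over the polynomial ring: its determinant is the
    characteristic polynomial up to sign, and its roots are the eigenvalues.\<close>
  define P :: "complex poly^'n^'n" where
    "P = (\<chi> i j. if i = j then [:A $ i $ j, -1:] else [:A $ i $ j:])"
  have Pz: "(\<chi> i j. poly (P $ i $ j) z) = A - mat z" for z
    by (simp add: P_def vec_eq_iff mat_def)
  have det: "poly (det P) z = det (A - mat z)" for z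
    unfolding Pz[symmetric] det_def by (simp add: poly_sum poly_prod poly_mult)
  have matz: "mat z *v v = z *s v" for z and v :: "complex^'n"
    by (simp add: vec_eq_iff matrix_vector_mult_def mat_def if_distrib[of "\<lambda>x. x * _"] cong: if_cong)
  have ker: "det (A - mat z) = 0 \<longleftrightarrow> (\<exists>v. v \<noteq> 0 \<and> A *v v = z *s v)" for z
    using invertible_det_nz[of "A - mat z"] invertible_left_inverse[of "A - mat z"]
      matrix_left_invertible_ker[of "A - mat z"]
    by (auto simp: matrix_vector_mult_diff_rdistrib matz)
  obtain K where K: "\<And>v. norm (A *v v) \<le> norm v * K" "K > 0"
    using bounded_linear.pos_bounded[OF matrix_vector_mul_bounded_linear] by blast
  have nz: "norm (z *s v) = norm z * norm v" for z and v :: "complex^'n"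
    by (simp add: norm_vec_def norm_mult L2_set_def
        power_mult_distrib sum_distrib_left[symmetric] real_sqrt_mult)
  \<comment> \<open>\<open>K\<close> bounds the operator norm, so \<open>K + 1\<close> is no
    eigenvalue. Hence \<open>det P\<close> is not the zero polynomial and has finitely many
    roots.\<close>
  have "det (A - mat (of_real (K + 1))) \<noteq> 0"
  proof
    assume "det (A - mat (of_real (K + 1))) = 0"
    then obtain v where v: "v \<noteq> 0" "A *v v = of_real (K + 1) *s v" using ker by blast
    then have "(K + 1) * norm v \<le> norm v * K" using K(1)[of v] K(2) by (simp add: nz del: of_real_add)
    then show False using v(1) by (simp add: algebra_simps)
  qed
  then have "det P \<noteq> 0" using det by (metis poly_0)
  then have "finite {z. poly (det P) z = 0}" by (rule poly_roots_finite)
  then show ?thesis by (simp add: det ker)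
qed

lemma spectral_radius_less_one_eigenvalue:
  fixes A :: "real^'n^'n"
  assumes "spectral_radius A < 1" "v \<noteq> 0" "(\<chi> i j. complex_of_real (A $ i $ j)) *v v = z *s v"
  shows "norm z < 1"
proof -
  let ?C = "\<chi> i j. complex_of_real (A $ i $ j)"
  have "{norm z |z. \<exists>v. v \<noteq> 0 \<and> ?C *v v = z *s v} = norm ` {z. \<exists>v. v \<noteq> 0 \<and> ?C *v v = z *s v}"
    by blast
  then have "norm z \<le> spectral_radius A"
    unfolding spectral_radius_def using assms(2,3) finite_eigenvalues[of ?C] by (intro Max_ge) auto
  with assms(1) show ?thesis by simp
qed

section \<open>Summable bounds for the powers of a real matrix\<close>

lemma matpow_vector_mult: "matpow A k *v x = (((*v) A) ^^ k) x"
  by (induction k) (simp_all add: matrix_vector_mul_assoc[symmetric])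

lemma matpow_scaleR: "matpow (c *\<^sub>R A) k = c ^ k *\<^sub>R matpow A k"
  by (induction k) (simp_all add: scalar_matrix_assoc[symmetric] matrix_scalar_ac mult.commute)

text \<open>The eigenvalues are complex, so the real orbit is embedded into
  \<open>complex^'n\<close> by \<open>c\<close>, which commutes with the matrix and preserves
  norms.\<close>

lemma summable_matpow_vector:
  fixes A :: "real^'n^'n"
  assumes "spectral_radius A < 1"
  shows "summable (\<lambda>k. norm (matpow A k *v x))"
proof -
  define c :: "real^'n \<Rightarrow> complex^'n" where "c v = (\<chi> i. complex_of_real (v $ i))" for v
  let ?C = "\<chi> i j. complex_of_real (A $ i $ j)"
  have "(((*v) ?C) ^^ k) (c x) = c (matpow A k *v x)" for k
    unfolding matpow_vector_mult by (induction k) (simp_all add: c_def vec_eq_iff matrix_vector_mult_def)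
  then have iter: "norm ((((*v) ?C) ^^ k) (c x)) = norm (matpow A k *v x)" for k
    by (simp add: c_def norm_vec_def)
  obtain p where "p \<noteq> 0" "poly_act ?C (c x) p = 0" using annihilating_poly_exists .
  then have "summable (\<lambda>k. norm ((((*v) ?C) ^^ k) (c x)))"
    by (intro summable_orbit_of_annihilated spectral_radius_less_one_eigenvalue[OF assms])
  then show ?thesis unfolding iter .
qed

text \<open>The series of the stationary solution applies the k-th power to a vector that changes
  with k, so summability along one fixed orbit does not suffice. Adding the norms of the orbits of
  the finitely many basis vectors gives a bound uniform in \<open>x\<close>.\<close>

lemma matpow_summable_bound:
  fixes A :: "real^'n^'n"
  assumes "spectral_radius A < 1"
  obtains K where "summable K" "\<And>k. 0 \<le> K k" "\<And>k x. norm (matpow A k *v x) \<le> K k * norm x"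
proof
  let ?K = "\<lambda>k. \<Sum>j\<in>UNIV. norm (matpow A k *v axis j 1)"
  show "summable ?K" by (intro summable_sum summable_matpow_vector assms)
  show "0 \<le> ?K k" for k by (simp add: sum_nonneg)
  fix k x
  have "matpow A k *v x = (\<Sum>j\<in>UNIV. x $ j *\<^sub>R (matpow A k *v axis j 1))"
    by (subst matrix_mult_sum) (simp add: matrix_vector_mul_component vec_eq_iff scalar_mult_eq_scaleR column_def matrix_vector_mult_basis)
  also have "norm \<dots> \<le> (\<Sum>j\<in>UNIV. norm (x $ j *\<^sub>R (matpow A k *v axis j 1)))" by (rule norm_sum)
  also have "\<dots> \<le> (\<Sum>j\<in>UNIV. norm x * norm (matpow A k *v axis j 1))"
    by (intro sum_mono) (simp add: mult_right_mono component_le_norm_cart)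
  finally show "norm (matpow A k *v x) \<le> ?K k * norm x" by (simp add: sum_distrib_left mult.commute)
qed

section \<open>Logarithmic moments of the standard normal distribution\<close>

text \<open>Serves to dominate the quotients (exp (h y) - 1) / h by |y| exp (d |y|), uniformly over
  0 < |h| \<le> d.\<close>

lemma abs_exp_diff_one_le: "\<bar>exp u - 1\<bar> \<le> \<bar>u\<bar> * exp \<bar>u\<bar>" for u :: real
proof (cases "u \<ge> 0")
  case True
  have "1 - u \<le> exp (- u)" using exp_ge_add_one_self[of "- u"] by simp
  then have "(1 - u) * exp u \<le> 1" by (simp add: exp_minus field_simps)
  with True show ?thesis by (simp add: algebra_simps)
next
  case False
  then have "\<bar>exp u - 1\<bar> = 1 - exp u" by simp
  also have "\<dots> \<le> \<bar>u\<bar> * 1" using exp_ge_add_one_self[of u] False by linarith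
  also have "\<dots> \<le> \<bar>u\<bar> * exp \<bar>u\<bar>" by (intro mult_left_mono) auto
  finally show ?thesis .
qed

text \<open>Dominated convergence for the difference quotients; integrability at two exponents
  around \<open>s\<close> supplies the dominating function. The derivative is an integral of the
  same shape with weight \<open>w x * L x\<close>, so the lemma can be iterated.\<close>

lemma DERIV_integral_exp:
  fixes w L :: "'a \<Rightarrow> real"
  assumes [measurable]: "w \<in> borel_measurable M" "L \<in> borel_measurable M"
    and int: "\<And>r. a < r \<Longrightarrow> r < b \<Longrightarrow> integrable M (\<lambda>x. w x * exp (r * L x))"
    and s: "a < s" "s < b"
  shows "integrable M (\<lambda>x. w x * L x * exp (s * L x))"
    and "((\<lambda>r. \<integral>x. w x * exp (r * L x) \<partial>M) has_real_derivative (\<integral>x. w x * L x * exp (s * L x) \<partial>M)) (at s)"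
proof -
  obtain d where d: "d > 0" "a < s - 2 * d" "s + 2 * d < b"
  proof
    show "min (s - a) (b - s) / 4 > 0" "a < s - 2 * (min (s - a) (b - s) / 4)"
      "s + 2 * (min (s - a) (b - s) / 4) < b" using s by (auto simp: min_def field_simps)
  qed
  \<comment> \<open>Of the margin \<open>2 * d\<close>, one \<open>d\<close> pays for
    \<open>exp (d * \<bar>L x\<bar>)\<close> from the difference quotient and the other absorbs the
    factor |L x|, which is at most \<open>exp (d * \<bar>L x\<bar>) / d\<close>. Both exponents
    \<open>s + 2 * d\<close> and \<open>s - 2 * d\<close> are kept because \<open>L x\<close> may
    have either sign.\<close>
  define B where "B x = \<bar>w x\<bar> * (exp ((s + 2 * d) * L x) + exp ((s - 2 * d) * L x)) / d" for x
  have "integrable M (\<lambda>x. (\<bar>w x * exp ((s + 2 * d) * L x)\<bar> + \<bar>w x * exp ((s - 2 * d) * L x)\<bar>) / d)"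
    using d by (intro integrable_divide Bochner_Integration.integrable_add integrable_abs int) auto
  also have "(\<lambda>x. (\<bar>w x * exp ((s + 2 * d) * L x)\<bar> + \<bar>w x * exp ((s - 2 * d) * L x)\<bar>) / d) = B"
    by (auto simp: B_def fun_eq_iff abs_mult algebra_simps)
  finally have B: "integrable M B" .
  have key: "\<bar>w x\<bar> * exp (s * L x) * (\<bar>L x\<bar> * exp (d * \<bar>L x\<bar>)) \<le> B x" for x
  proof -
    have "d * \<bar>L x\<bar> \<le> exp (d * \<bar>L x\<bar>)" using exp_ge_add_one_self[of "d * \<bar>L x\<bar>"] by linarith
    then have "\<bar>L x\<bar> \<le> exp (d * \<bar>L x\<bar>) / d" using d by (simp add: field_simps)
    then have "\<bar>L x\<bar> * exp (d * \<bar>L x\<bar>) \<le> exp (d * \<bar>L x\<bar>) / d * exp (d * \<bar>L x\<bar>)"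
      by (intro mult_right_mono) auto
    also have "\<dots> = exp (2 * d * \<bar>L x\<bar>) / d" by (simp add: exp_add[symmetric])
    also have "\<dots> \<le> (exp (2 * d * L x) + exp (- 2 * d * L x)) / d"
      using d by (intro divide_right_mono) (auto simp: abs_if)
    finally have "\<bar>w x\<bar> * exp (s * L x) * (\<bar>L x\<bar> * exp (d * \<bar>L x\<bar>)) \<le>
        \<bar>w x\<bar> * exp (s * L x) * ((exp (2 * d * L x) + exp (- 2 * d * L x)) / d)"
      by (intro mult_left_mono) auto
    also have "\<dots> = B x" by (simp add: B_def exp_add exp_diff exp_minus algebra_simps divide_inverse)
    finally show ?thesis .
  qed
  have Lb: "\<bar>w x * L x * exp (s * L x)\<bar> \<le> B x" for x
  proof -
    have "\<bar>w x * L x * exp (s * L x)\<bar> = \<bar>w x\<bar> * exp (s * L x) * (\<bar>L x\<bar> * 1)" by (simp add: abs_mult)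
    also have "\<dots> \<le> \<bar>w x\<bar> * exp (s * L x) * (\<bar>L x\<bar> * exp (d * \<bar>L x\<bar>))"
      using d by (intro mult_left_mono) auto
    finally show ?thesis using key[of x] by linarith
  qed
  show "integrable M (\<lambda>x. w x * L x * exp (s * L x))"
    by (rule Bochner_Integration.integrable_bound[OF B]) (auto intro!: AE_I2 order_trans[OF Lb])
  let ?F = "\<lambda>r. \<integral>x. w x * exp (r * L x) \<partial>M"
  let ?q = "\<lambda>h x. w x * exp (s * L x) * ((exp (h * L x) - 1) / h)"
  have quot: "(?F (s + h) - ?F s) / h = (\<integral>x. ?q h x \<partial>M)" if h: "\<bar>h\<bar> \<le> d" "h \<noteq> 0" for h
  proof -
    have "?F (s + h) - ?F s = (\<integral>x. w x * exp ((s + h) * L x) - w x * exp (s * L x) \<partial>M)"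
      using h d s by (intro Bochner_Integration.integral_diff[symmetric] int) auto
    then have "(?F (s + h) - ?F s) / h = (\<integral>x. (w x * exp ((s + h) * L x) - w x * exp (s * L x)) / h \<partial>M)"
      by simp
    also have "\<dots> = (\<integral>x. ?q h x \<partial>M)"
      by (intro Bochner_Integration.integral_cong) (auto simp: exp_add algebra_simps diff_divide_distrib)
    finally show ?thesis .
  qed
  have qb: "\<bar>?q h x\<bar> \<le> B x" if h: "\<bar>h\<bar> \<le> d" "h \<noteq> 0" for h x
  proof -
    have "\<bar>exp (h * L x) - 1\<bar> \<le> \<bar>h * L x\<bar> * exp \<bar>h * L x\<bar>" by (rule abs_exp_diff_one_le)
    also have "\<dots> \<le> \<bar>h * L x\<bar> * exp (d * \<bar>L x\<bar>)"
      using h by (intro mult_left_mono) (auto simp: abs_mult mult_right_mono)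
    finally have "\<bar>(exp (h * L x) - 1) / h\<bar> \<le> \<bar>L x\<bar> * exp (d * \<bar>L x\<bar>)"
      using h by (simp add: abs_mult field_simps)
    then have "\<bar>w x\<bar> * exp (s * L x) * \<bar>(exp (h * L x) - 1) / h\<bar> \<le>
      \<bar>w x\<bar> * exp (s * L x) * (\<bar>L x\<bar> * exp (d * \<bar>L x\<bar>))" by (intro mult_left_mono) auto
    then show ?thesis using key[of x] by (simp add: abs_mult)
  qed
  \<comment> \<open>Dominated convergence is about sequences, so the limit at 0 is tested along an
    arbitrary null sequence of nonzero increments.\<close>
  show "(?F has_real_derivative (\<integral>x. w x * L x * exp (s * L x) \<partial>M)) (at s)"
    unfolding DERIV_def tendsto_at_iff_sequentially comp_def
  proof (intro allI impI)
    fix X :: "nat \<Rightarrow> real" assume X: "\<forall>i. X i \<in> UNIV - {0}" "X \<longlonglongrightarrow> 0"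
    \<comment> \<open>The bound by \<open>B\<close> holds only for increments of size at most
      \<open>d\<close>; the sequence is shifted by \<open>N\<close> to reach that range, and the
      shift is undone at the end.\<close>
    obtain N where N: "\<And>n. n \<ge> N \<Longrightarrow> \<bar>X n\<bar> \<le> d"
      using LIMSEQ_D[OF X(2) d(1)] by (force intro: less_imp_le)
    have "(\<lambda>n. \<integral>x. ?q (X (n + N)) x \<partial>M) \<longlonglongrightarrow> (\<integral>x. w x * L x * exp (s * L x) \<partial>M)"
    proof (rule integral_dominated_convergence[OF _ _ B])
      show "AE x in M. norm (?q (X (i + N)) x) \<le> B x" for i
        using qb N X(1) by (intro AE_I2) auto
      have "((\<lambda>h. (exp (h * y) - 1) / h) \<longlongrightarrow> y) (at 0)" for y :: real
      proof -
        have "((\<lambda>h. exp (h * y)) has_real_derivative y) (at 0)"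
          by (auto intro!: derivative_eq_intros)
        then show ?thesis by (simp add: DERIV_def)
      qed
      moreover have "filterlim (\<lambda>n. X (n + N)) (at 0) sequentially"
        using X by (auto simp: filterlim_at intro!: LIMSEQ_ignore_initial_segment)
      ultimately have "(\<lambda>n. (exp (X (n + N) * L x) - 1) / X (n + N)) \<longlonglongrightarrow> L x" for x
        by (rule filterlim_compose)
      then have "(\<lambda>n. ?q (X (n + N)) x) \<longlonglongrightarrow> w x * exp (s * L x) * L x" for x
        by (intro tendsto_mult tendsto_const)
      then show "AE x in M. (\<lambda>n. ?q (X (n + N)) x) \<longlonglongrightarrow> w x * L x * exp (s * L x)"
        by (simp add: mult_ac)
    qed measurable
    then have "(\<lambda>n. (?F (s + X (n + N)) - ?F s) / X (n + N)) \<longlonglongrightarrow> (\<integral>x. w x * L x * exp (s * L x) \<partial>M)"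
      using quot N X(1) by (subst quot) auto
    then show "(\<lambda>n. (?F (s + X n) - ?F s) / X n) \<longlonglongrightarrow> (\<integral>x. w x * L x * exp (s * L x) \<partial>M)"
      by (rule LIMSEQ_offset)
  qed
qed

section \<open>Absolute moments of the standard normal and their derivatives\<close>

text \<open>Substituting t = x^2 / 2 in Euler's integral for \<open>Gamma (s + 1 / 2)\<close> gives
  the moment over the positive half-line; evenness of the integrand doubles it.\<close>

lemma has_bochner_integral_std_normal_abs_powr:
  assumes s: "s > - 1 / 2"
  shows "has_bochner_integral lborel (\<lambda>x. std_normal_density x * exp (s * ln (x\<^sup>2)))
    (2 powr s * Gamma (s + 1 / 2) / sqrt pi)"
proof -
  let ?z = "s + 1 / 2"
  let ?f = "\<lambda>t. t powr (?z - 1) / exp t :: real"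
  let ?g = "\<lambda>x. x\<^sup>2 / 2 :: real"
  have "(?f has_integral Gamma ?z) {0..}" using s by (intro Gamma_integral_real) simp
  then have "(?f has_integral Gamma ?z) {0<..}"
    by (subst has_integral_spike_set_eq[of _ "{0..}"])
      (auto intro: negligible_subset[OF negligible_sing[of 0]])
  then have f: "?f absolutely_integrable_on {0<..}" "integral {0<..} ?f = Gamma ?z"
    by (auto intro!: nonnegative_absolutely_integrable_1 simp: has_integral_integrable integral_unique)
  have img: "?g ` {0<..} = {0<..}"
  proof (intro equalityI subsetI)
    fix y :: real assume "y \<in> {0<..}"
    then show "y \<in> ?g ` {0<..}" by (intro image_eqI[of _ _ "sqrt (2 * y)"]) auto
  qed auto
  have "inj_on ?g {0<..}" by (auto simp: inj_on_def)
  moreover have "(?g has_field_derivative x) (at x within {0<..})" for x :: real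
    by (auto intro!: derivative_eq_intros)
  ultimately have "(\<lambda>x. \<bar>x\<bar> * ?f (?g x)) absolutely_integrable_on {0<..} \<and>
      integral {0<..} (\<lambda>x. \<bar>x\<bar> * ?f (?g x)) = Gamma ?z"
    using f has_absolute_integral_change_of_variables_1'[of "{0<..}" ?g "\<lambda>x. x" ?f "Gamma ?z"]
    unfolding img by auto
  then have "has_bochner_integral lebesgue (\<lambda>x. indicator {0<..} x * (\<bar>x\<bar> * ?f (?g x))) (Gamma ?z)"
    by (auto simp: has_bochner_integral_iff set_integrable_def
        set_lebesgue_integral_eq_integral(2)[symmetric] set_lebesgue_integral_def)
  \<comment> \<open>This constant cancels the power of 2 coming from (x^2 / 2) powr (s - 1/2) and
    inserts the normalisation of the normal density.\<close>
  then have "has_bochner_integral lebesgue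
      (\<lambda>x. 2 powr (s - 1 / 2) / sqrt (2 * pi) * (indicator {0<..} x * (\<bar>x\<bar> * ?f (?g x))))
      (2 powr (s - 1 / 2) / sqrt (2 * pi) * Gamma ?z)"
    by (rule has_bochner_integral_mult_right)
  also have "(\<lambda>x. 2 powr (s - 1 / 2) / sqrt (2 * pi) * (indicator {0<..} x * (\<bar>x\<bar> * ?f (?g x)))) =
     (\<lambda>x. indicator {0<..} x * (std_normal_density x * exp (s * ln (x\<^sup>2))))"
  proof
    fix x :: real
    show "2 powr (s - 1 / 2) / sqrt (2 * pi) * (indicator {0<..} x * (\<bar>x\<bar> * ?f (?g x))) =
      indicator {0<..} x * (std_normal_density x * exp (s * ln (x\<^sup>2)))"
    proof (cases "x > 0")
      case True
      have "x\<^sup>2 > 0" using True by simp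
      have "2 powr (s - 1 / 2) * ?g x powr (s - 1 / 2) = (x\<^sup>2) powr (s - 1 / 2)"
        by (simp add: powr_mult[symmetric])
      also have "\<dots> = exp ((s - 1 / 2) * ln (x\<^sup>2))" using True by (simp add: powr_def)
      also have "\<dots> = exp (s * ln (x\<^sup>2) - ln x)" using True by (simp add: ln_realpow algebra_simps)
      also have "\<dots> = exp (s * ln (x\<^sup>2)) / x" using True by (simp add: exp_diff)
      finally have "2 powr (s - 1 / 2) * (x * ?g x powr (s - 1 / 2)) = exp (s * ln (x\<^sup>2))"
        using True by (simp add: field_simps)
      then show ?thesis using True
        by (simp add: std_normal_density_def exp_minus field_simps)
    qed simp
  qed
  finally have "has_bochner_integral lborel
      (\<lambda>x. indicator {0<..} x * (std_normal_density x * exp (s * ln (x\<^sup>2))))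
      (2 powr (s - 1 / 2) / sqrt (2 * pi) * Gamma ?z)"
    by (simp add: has_bochner_integral_iff integrable_completion integral_completion)
  \<comment> \<open>The substitution ran over the open half-line, the evenness rule asks for the
    closed one; they differ by the null set {0}.\<close>
  then have "has_bochner_integral lborel
      (\<lambda>x. indicator {0..} x *\<^sub>R (std_normal_density x * exp (s * ln (x\<^sup>2))))
      (2 powr (s - 1 / 2) / sqrt (2 * pi) * Gamma ?z)"
    by (rule has_bochner_integralI_AE)
      (measurable, use AE_lborel_singleton[of "0::real"] in \<open>auto elim!: eventually_mono simp: indicator_def\<close>)
  then have "has_bochner_integral lborel (\<lambda>x. std_normal_density x * exp (s * ln (x\<^sup>2)))
      (2 *\<^sub>R (2 powr (s - 1 / 2) / sqrt (2 * pi) * Gamma ?z))"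
    by (rule has_bochner_integral_even_function) (simp add: std_normal_density_def)
  also have "2 *\<^sub>R (2 powr (s - 1 / 2) / sqrt (2 * pi) * Gamma ?z) = 2 powr s * Gamma ?z / sqrt pi"
  proof -
    have "2 powr (s - 1 / 2) = 2 powr s / sqrt 2" by (simp add: powr_diff powr_half_sqrt)
    then have "2 *\<^sub>R (2 powr (s - 1 / 2) / sqrt (2 * pi) * Gamma ?z) =
        2 * (2 powr s / sqrt 2) / (sqrt 2 * sqrt pi) * Gamma ?z" by (simp add: real_sqrt_mult)
    also have "\<dots> = 2 powr s * (2 / (sqrt 2 * sqrt 2)) * Gamma ?z / sqrt pi"
      by (simp only: times_divide_eq_left times_divide_eq_right divide_divide_eq_left mult_ac)
    finally show ?thesis by simp
  qed
  finally show ?thesis .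
qed

text \<open>The series of the trigamma function at 1/2 is four times the sum of 1/m^2 over odd m,
  that is, of the Basel sum minus its even part, which is a quarter of it.\<close>

lemma Polygamma_1_one_half: "Polygamma 1 (1 / 2 :: real) = pi\<^sup>2 / 2"
proof -
  let ?f = "\<lambda>n. 1 / (real n + 1)\<^sup>2"
  have all: "?f sums (pi\<^sup>2 / 6)" using inverse_squares_sums by (simp add: add.commute)
  \<comment> \<open>Since \<open>?f n\<close> has denominator (n + 1)^2, odd indices give the even
    denominators.\<close>
  have "(\<lambda>n. ?f (n * 2 + 1)) sums (1 / 4 * (pi\<^sup>2 / 6))"
    using sums_mult[OF all, of "1 / 4"] by (simp add: power2_eq_square field_simps)
  moreover have "(\<lambda>n. \<Sum>i = n * 2..<n * 2 + 2. ?f i) sums (pi\<^sup>2 / 6)"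
    using all by (rule sums_group) simp
  then have "(\<lambda>n. ?f (n * 2) + ?f (n * 2 + 1)) sums (pi\<^sup>2 / 6)"
    by (simp add: numeral_2_eq_2)
  ultimately have "(\<lambda>n. ?f (n * 2)) sums (pi\<^sup>2 / 6 - 1 / 4 * (pi\<^sup>2 / 6))"
    using sums_diff by fastforce
  from sums_mult[OF this, of 4]
  have "(\<lambda>n. 4 * ?f (n * 2)) sums (pi\<^sup>2 / 2)" by simp
  moreover have "4 * ?f (n * 2) = inverse ((1 / 2 + real n)\<^sup>2)" for n
    by (simp add: field_simps power2_eq_square)
  ultimately have "(\<lambda>n. inverse ((1 / 2 + real n)\<^sup>2)) sums (pi\<^sup>2 / 2)" by simp
  moreover have "(\<lambda>n. inverse ((1 / 2 + real n)\<^sup>2)) sums ((- 1) ^ Suc 1 * Polygamma 1 (1 / 2) / fact 1)"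
    using Polygamma_LIMSEQ[of "1 / 2 :: real" 1] by (simp add: numeral_2_eq_2)
  ultimately show ?thesis using sums_unique2 by fastforce
qed

text \<open>\<open>\<phi> s\<close> is the absolute moment of order \<open>2 * s\<close> and \<open>\<phi>'\<close> its derivative.\<close>

context
  fixes \<phi> \<phi>' :: "real \<Rightarrow> real"
  defines "\<phi> \<equiv> \<lambda>s. 2 powr s * Gamma (s + 1 / 2) / sqrt pi"
    and "\<phi>' \<equiv> \<lambda>s. \<phi> s * (ln 2 + Digamma (s + 1 / 2))"
begin

text \<open>Logarithmic differentiation: the quotient of \<open>\<phi>'\<close> by
  \<open>\<phi>\<close> is \<open>ln 2 + Digamma (s + 1 / 2)\<close>, whose own derivative is the
  trigamma function.\<close>

lemma DERIV_abs_moment: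
  assumes "s > - 1 / 2"
  shows "(\<phi> has_real_derivative \<phi>' s) (at s)"
    and "(\<phi>' has_real_derivative (\<phi>' s * (ln 2 + Digamma (s + 1 / 2)) + \<phi> s * Polygamma 1 (s + 1 / 2))) (at s)"
proof -
  have nonpos: "s + 1 / 2 \<notin> \<int>\<^sub>\<le>\<^sub>0" using assms nonpos_Ints_nonpos[of "s + 1 / 2"] by linarith
  have "(Gamma has_real_derivative Gamma (s + 1 / 2) * Digamma (s + 1 / 2)) (at (s + 1 / 2))"
    by (rule has_field_derivative_Gamma[OF nonpos])
  then have G: "((\<lambda>s. Gamma (s + 1 / 2)) has_real_derivative Gamma (s + 1 / 2) * Digamma (s + 1 / 2)) (at s)"
    by (rule DERIV_shift[THEN iffD1])
  have "((\<lambda>s. 2 powr s) has_real_derivative 2 powr s * ln 2) (at s)"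
    by (auto intro!: derivative_eq_intros)
  from DERIV_cdivide[OF DERIV_mult[OF this G], of "sqrt pi"]
  show 1: "(\<phi> has_real_derivative \<phi>' s) (at s)"
    unfolding \<phi>_def \<phi>'_def by (simp add: algebra_simps)
  have "((\<lambda>s. ln 2 + Digamma (s + 1 / 2)) has_real_derivative Polygamma 1 (s + 1 / 2)) (at s)"
  proof -
    have "(Digamma has_real_derivative Polygamma (Suc 0) (s + 1 / 2)) (at (s + 1 / 2))"
      by (rule has_field_derivative_Polygamma[OF nonpos])
    from DERIV_add[OF DERIV_const[of "ln 2"] DERIV_shift[THEN iffD1, OF this]]
    show ?thesis by simp
  qed
  from DERIV_mult[OF 1 this]
  show "(\<phi>' has_real_derivative (\<phi>' s * (ln 2 + Digamma (s + 1 / 2)) + \<phi> s * Polygamma 1 (s + 1 / 2))) (at s)"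
    unfolding \<phi>'_def[abs_def] by (simp add: mult.commute)
qed

text \<open>Each derivative is computed twice, under the integral sign and from the Gamma closed
  form; uniqueness of derivatives identifies the two values.\<close>

lemma std_normal_abs_powr_ln:
  assumes "s > - 1 / 2"
  shows "has_bochner_integral lborel (\<lambda>x. std_normal_density x * ln (x\<^sup>2) * exp (s * ln (x\<^sup>2))) (\<phi>' s)"
    and "has_bochner_integral lborel (\<lambda>x. std_normal_density x * ln (x\<^sup>2) * ln (x\<^sup>2) * exp (s * ln (x\<^sup>2)))
      (\<phi>' s * (ln 2 + Digamma (s + 1 / 2)) + \<phi> s * Polygamma 1 (s + 1 / 2))"
proof -
  have eq: "\<phi> r = (\<integral>x. std_normal_density x * exp (r * ln (x\<^sup>2)) \<partial>lborel)" if "r > - 1 / 2" for r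
    using has_bochner_integral_std_normal_abs_powr[OF that] by (simp add: has_bochner_integral_iff \<phi>_def)
  have first: "has_bochner_integral lborel (\<lambda>x. std_normal_density x * ln (x\<^sup>2) * exp (s * ln (x\<^sup>2))) (\<phi>' s)"
    if "s > - 1 / 2" for s
  proof -
    \<comment> \<open>The moments exist to the right of -1/2; \<open>s + 1\<close> is just some
      right endpoint beyond \<open>s\<close>.\<close>
    note D = DERIV_integral_exp[of std_normal_density lborel "\<lambda>x. ln (x\<^sup>2)" "- 1 / 2" "s + 1" s]
    have int: "integrable lborel (\<lambda>x. std_normal_density x * exp (r * ln (x\<^sup>2)))" if "r > - 1 / 2" for r
      using has_bochner_integral_std_normal_abs_powr[OF that] by (simp add: has_bochner_integral_iff)
    have "(\<phi> has_real_derivative (\<integral>x. std_normal_density x * ln (x\<^sup>2) * exp (s * ln (x\<^sup>2)) \<partial>lborel)) (at s)"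
      by (rule has_field_derivative_transform_within_open[OF D(2), of "{- 1 / 2<..}"]) (use that int eq in auto)
    then show ?thesis using D(1) int that DERIV_unique[OF DERIV_abs_moment(1)[OF that]]
      by (auto simp: has_bochner_integral_iff)
  qed
  show "has_bochner_integral lborel (\<lambda>x. std_normal_density x * ln (x\<^sup>2) * exp (s * ln (x\<^sup>2))) (\<phi>' s)"
    using first assms .
  note D = DERIV_integral_exp[of "\<lambda>x. std_normal_density x * ln (x\<^sup>2)" lborel "\<lambda>x. ln (x\<^sup>2)" "- 1 / 2" "s + 1" s]
  have eq': "\<phi>' r = (\<integral>x. std_normal_density x * ln (x\<^sup>2) * exp (r * ln (x\<^sup>2)) \<partial>lborel)" if "r > - 1 / 2" for r
    using first[OF that] by (simp add: has_bochner_integral_iff)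
  have int: "integrable lborel (\<lambda>x. std_normal_density x * ln (x\<^sup>2) * exp (r * ln (x\<^sup>2)))" if "r > - 1 / 2" for r
    using first[OF that] by (simp add: has_bochner_integral_iff)
  have "(\<phi>' has_real_derivative (\<integral>x. std_normal_density x * ln (x\<^sup>2) * ln (x\<^sup>2) * exp (s * ln (x\<^sup>2)) \<partial>lborel)) (at s)"
    by (rule has_field_derivative_transform_within_open[OF D(2), of "{- 1 / 2<..}"]) (use assms int eq' in auto)
  then show "has_bochner_integral lborel (\<lambda>x. std_normal_density x * ln (x\<^sup>2) * ln (x\<^sup>2) * exp (s * ln (x\<^sup>2)))
      (\<phi>' s * (ln 2 + Digamma (s + 1 / 2)) + \<phi> s * Polygamma 1 (s + 1 / 2))"
    using D(1) int assms DERIV_unique[OF DERIV_abs_moment(2)[OF assms]]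
    by (auto simp: has_bochner_integral_iff)
qed

text \<open>The first derivative at s = 0, where Digamma (1/2) = - euler_mascheroni - 2 ln
  2.\<close>

lemma std_normal_ln_sq:
  "has_bochner_integral lborel (\<lambda>x. std_normal_density x * ln (x\<^sup>2)) (- ln 2 - euler_mascheroni)"
  using std_normal_abs_powr_ln(1)[of 0]
  by (simp add: \<phi>'_def \<phi>_def Gamma_one_half_real Digamma_one_half)

lemma std_normal_ln_sq_squared:
  "has_bochner_integral lborel (\<lambda>x. std_normal_density x * (ln (x\<^sup>2))\<^sup>2)
    (pi\<^sup>2 / 2 + (- ln 2 - euler_mascheroni)\<^sup>2)"
proof -
  have "\<phi>' 0 * (ln 2 + Digamma (0 + 1 / 2)) + \<phi> 0 * Polygamma 1 (0 + 1 / 2)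
    = pi\<^sup>2 / 2 + (- ln 2 - euler_mascheroni)\<^sup>2"
  proof -
    have "\<phi> 0 = 1" "\<phi>' 0 = - ln 2 - euler_mascheroni"
      by (simp_all add: \<phi>'_def \<phi>_def Gamma_one_half_real Digamma_one_half)
    then show ?thesis using Polygamma_1_one_half by (simp add: Digamma_one_half power2_eq_square)
  qed
  then show ?thesis using std_normal_abs_powr_ln(2)[of 0]
    by (simp add: power2_eq_square mult.assoc)
qed

lemma std_normal_abs_ln_sq:
  "has_bochner_integral lborel (\<lambda>x. std_normal_density x * (\<bar>x\<bar> * ln (x\<^sup>2)))
    (sqrt (2 / pi) * (ln 2 - euler_mascheroni))"
proof -
  have "\<phi>' (1 / 2) = sqrt (2 / pi) * (ln 2 - euler_mascheroni)"
    by (simp add: \<phi>'_def \<phi>_def powr_half_sqrt real_sqrt_divide Digamma_def)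
  moreover have "std_normal_density x * ln (x\<^sup>2) * exp (1 / 2 * ln (x\<^sup>2)) = std_normal_density x * (\<bar>x\<bar> * ln (x\<^sup>2))"
    for x
  \<comment> \<open>At 0 the exponential is 1 rather than |0|, because \<open>ln 0 = 0\<close>; the
    factor \<open>ln (x\<^sup>2)\<close> makes both sides vanish there.\<close>
  proof (cases "x = 0")
    case False
    then have "ln (x\<^sup>2) = 2 * ln \<bar>x\<bar>" using ln_realpow[of "\<bar>x\<bar>" 2] by simp
    with False have "exp (1 / 2 * ln (x\<^sup>2)) = \<bar>x\<bar>" by simp
    then show ?thesis by simp
  qed simp
  ultimately show ?thesis using std_normal_abs_powr_ln(1)[of "1 / 2"] by (simp only:)
qed

end

text \<open>The integrand is odd, and integrable because its absolute value is that of the integrand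
  in \<open>std_normal_abs_ln_sq\<close>.\<close>

lemma std_normal_mult_ln_sq:
  "has_bochner_integral lborel (\<lambda>x. std_normal_density x * (x * ln (x\<^sup>2))) 0"
proof (rule has_bochner_integral_odd_function)
  have "integrable lborel (\<lambda>x. std_normal_density x * (\<bar>x\<bar> * ln (x\<^sup>2)))"
    using std_normal_abs_ln_sq by (simp add: has_bochner_integral_iff)
  then have "integrable lborel (\<lambda>x. std_normal_density x * (x * ln (x\<^sup>2)))"
    by (rule Bochner_Integration.integrable_bound) (auto simp: abs_mult)
  then have "integrable lborel (\<lambda>x. indicator {0..} x *\<^sub>R (std_normal_density x * (x * ln (x\<^sup>2))))"
    by (intro integrable_mult_indicator) auto
  then show "has_bochner_integral lborel (\<lambda>x. indicator {0..} x *\<^sub>R (std_normal_density x * (x * ln (x\<^sup>2))))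
    (\<integral>x. indicator {0..} x *\<^sub>R (std_normal_density x * (x * ln (x\<^sup>2))) \<partial>lborel)"
    by (simp add: has_bochner_integral_iff)
qed (simp add: std_normal_density_def)

section \<open>Vector-valued moving averages of independent innovations\<close>

lemma borel_measurable_vec_nth:
  fixes f :: "'a \<Rightarrow> real^'n"
  assumes "f \<in> borel_measurable M"
  shows "(\<lambda>\<omega>. f \<omega> $ i) \<in> borel_measurable M"
  by (rule borel_measurable_continuous_on[OF _ assms]) (intro continuous_intros)

lemma borel_measurable_vecI:
  fixes f :: "'a \<Rightarrow> real^'n"
  assumes "\<And>i. (\<lambda>\<omega>. f \<omega> $ i) \<in> borel_measurable M"
  shows "f \<in> borel_measurable M"
  using assms by (subst borel_measurable_euclidean_space) (auto simp: Basis_vec_def inner_axis)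

lemma borel_measurable_matrix_vector_mult:
  fixes A :: "real^'n^'m"
  assumes "f \<in> borel_measurable M"
  shows "(\<lambda>\<omega>. A *v f \<omega>) \<in> borel_measurable M"
  by (rule borel_measurable_continuous_on[OF _ assms])
    (intro linear_continuous_on matrix_vector_mul_bounded_linear)

lemma has_bochner_integral_vecI:
  fixes f :: "'a \<Rightarrow> real^'n"
  assumes "\<And>i. has_bochner_integral M (\<lambda>\<omega>. f \<omega> $ i) (c $ i)"
  shows "has_bochner_integral M f c"
proof -
  have "has_bochner_integral M (\<lambda>\<omega>. \<Sum>i\<in>UNIV. f \<omega> $ i *\<^sub>R axis i 1) (\<Sum>i\<in>UNIV. c $ i *\<^sub>R axis i 1 :: real^'n)"
    by (intro has_bochner_integral_sum has_bochner_integral_scaleR_left assms)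
  moreover have "(\<Sum>i\<in>UNIV. x $ i *\<^sub>R axis i 1) = x" for x :: "real^'n"
    using basis_expansion[of x] by (simp add: scalar_mult_eq_scaleR)
  ultimately show ?thesis by (simp only:)
qed

text \<open>Exchanging sum and integral of nonnegative terms bounds the expectation of the series by
  C times the sum of \<open>a\<close>; a variable of finite expectation is finite almost
  surely.\<close>

lemma (in prob_space) AE_summable_mult:
  fixes Z :: "nat \<Rightarrow> 'a \<Rightarrow> real"
  assumes Z: "\<And>v. integrable M (Z v)" "\<And>v \<omega>. 0 \<le> Z v \<omega>" "\<And>v. expectation (Z v) \<le> C"
    and a: "summable a" "\<And>v. 0 \<le> a v"
  shows "AE \<omega> in M. summable (\<lambda>v. a v * Z v \<omega>)"
proof -
  have [measurable]: "Z v \<in> borel_measurable M" for v using Z(1) by auto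
  have C: "0 \<le> C" using order_trans[OF Bochner_Integration.integral_nonneg Z(3)[of 0]] Z(2) by simp
  have "(\<integral>\<^sup>+\<omega>. (\<Sum>v. ennreal (a v * Z v \<omega>)) \<partial>M) = (\<Sum>v. \<integral>\<^sup>+\<omega>. ennreal (a v * Z v \<omega>) \<partial>M)"
    by (intro nn_integral_suminf) measurable
  also have "\<dots> = (\<Sum>v. ennreal (a v * expectation (Z v)))"
    using Z a by (intro suminf_cong) (subst nn_integral_eq_integral, auto)
  also have "\<dots> \<le> (\<Sum>v. ennreal (a v * C))"
    using Z a by (intro suminf_le ennreal_leI mult_left_mono) auto
  also have "\<dots> = ennreal (\<Sum>v. a v * C)"
    using a C by (intro suminf_ennreal2 summable_mult2) auto
  also have "\<dots> < \<infinity>" by simp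
  finally have "AE \<omega> in M. (\<Sum>v. ennreal (a v * Z v \<omega>)) \<noteq> \<infinity>"
    by (intro nn_integral_PInf_AE) auto
  then show ?thesis
    by eventually_elim (rule summable_suminf_not_top, use Z a in auto)
qed

section \<open>Second moments of the news impact and of the log square\<close>

definition news :: "real \<Rightarrow> real \<Rightarrow> real \<Rightarrow> real" where
  "news \<Theta> \<xi> x = \<Theta> * x + \<xi> * (\<bar>x\<bar> - sqrt (2 / pi))"

text \<open>The mean of the logarithm of a chi-square variable with one degree of freedom.\<close>

abbreviation (input) mean_ln_sq :: real where
  "mean_ln_sq \<equiv> - ln 2 - euler_mascheroni"

definition centred_ln_sq :: "real \<Rightarrow> real" where
  "centred_ln_sq x = ln (x\<^sup>2) - mean_ln_sq"

lemma news_measurable [measurable]: "news \<Theta> \<xi> \<in> borel_measurable borel"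
  unfolding news_def by measurable

lemma centred_ln_sq_measurable [measurable]: "centred_ln_sq \<in> borel_measurable borel"
  unfolding centred_ln_sq_def by measurable

lemma std_normal_mult_abs:
  "has_bochner_integral lborel (\<lambda>x. std_normal_density x * (x * \<bar>x\<bar>)) 0"
proof (rule has_bochner_integral_odd_function)
  have "integrable lborel (\<lambda>x. std_normal_density x * x ^ 2)"
    by (rule integrable_std_normal_moment)
  then have "integrable lborel (\<lambda>x. std_normal_density x * (x * \<bar>x\<bar>))"
    by (rule Bochner_Integration.integrable_bound) (auto simp: abs_mult power2_eq_square)
  then have "integrable lborel (\<lambda>x. indicator {0..} x *\<^sub>R (std_normal_density x * (x * \<bar>x\<bar>)))"
    by (intro integrable_mult_indicator) auto
  then show "has_bochner_integral lborel (\<lambda>x. indicator {0..} x *\<^sub>R (std_normal_density x * (x * \<bar>x\<bar>)))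
    (\<integral>x. indicator {0..} x *\<^sub>R (std_normal_density x * (x * \<bar>x\<bar>)) \<partial>lborel)"
    by (simp add: has_bochner_integral_iff)
qed (simp add: std_normal_density_def)

context prob_space
begin

lemma has_bochner_integral_std_normal:
  assumes D: "distributed M lborel X std_normal_density"
    and "h \<in> borel_measurable borel" "has_bochner_integral lborel (\<lambda>x. std_normal_density x * h x) c"
  shows "has_bochner_integral M (\<lambda>\<omega>. h (X \<omega>)) c"
  using assms distributed_integral[OF D, of h] distributed_integrable[OF D, of h]
  by (auto simp: has_bochner_integral_iff)

lemma std_normal_moments:
  assumes D: "distributed M lborel X std_normal_density"
  shows "has_bochner_integral M X 0"
    and "has_bochner_integral M (\<lambda>\<omega>. (X \<omega>)\<^sup>2) 1"
    and "has_bochner_integral M (\<lambda>\<omega>. \<bar>X \<omega>\<bar>) (sqrt (2 / pi))"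
    and "has_bochner_integral M (\<lambda>\<omega>. X \<omega> * \<bar>X \<omega>\<bar>) 0"
    and "has_bochner_integral M (\<lambda>\<omega>. ln ((X \<omega>)\<^sup>2)) mean_ln_sq"
    and "has_bochner_integral M (\<lambda>\<omega>. (ln ((X \<omega>)\<^sup>2))\<^sup>2) (pi\<^sup>2 / 2 + mean_ln_sq\<^sup>2)"
    and "has_bochner_integral M (\<lambda>\<omega>. \<bar>X \<omega>\<bar> * ln ((X \<omega>)\<^sup>2)) (sqrt (2 / pi) * (ln 2 - euler_mascheroni))"
    and "has_bochner_integral M (\<lambda>\<omega>. X \<omega> * ln ((X \<omega>)\<^sup>2)) 0"
proof -
  note T = has_bochner_integral_std_normal[OF D]
  show "has_bochner_integral M X 0"
    using T[of "\<lambda>x. x"] std_normal_moment_odd[of 0] by simp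
  show "has_bochner_integral M (\<lambda>\<omega>. (X \<omega>)\<^sup>2) 1"
    using T[of "\<lambda>x. x\<^sup>2"] std_normal_moment_even[of 1] by (simp add: fact_numeral)
  show "has_bochner_integral M (\<lambda>\<omega>. \<bar>X \<omega>\<bar>) (sqrt (2 / pi))"
    using T[of "\<lambda>x. \<bar>x\<bar>"] std_normal_moment_abs_odd[of 0] by simp
  show "has_bochner_integral M (\<lambda>\<omega>. X \<omega> * \<bar>X \<omega>\<bar>) 0"
    by (rule T[of "\<lambda>x. x * \<bar>x\<bar>", OF _ std_normal_mult_abs]) measurable
  show "has_bochner_integral M (\<lambda>\<omega>. ln ((X \<omega>)\<^sup>2)) mean_ln_sq"
    by (rule T[of "\<lambda>x. ln (x\<^sup>2)", OF _ std_normal_ln_sq]) measurable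
  show "has_bochner_integral M (\<lambda>\<omega>. (ln ((X \<omega>)\<^sup>2))\<^sup>2) (pi\<^sup>2 / 2 + mean_ln_sq\<^sup>2)"
    by (rule T[of "\<lambda>x. (ln (x\<^sup>2))\<^sup>2", OF _ std_normal_ln_sq_squared]) measurable
  show "has_bochner_integral M (\<lambda>\<omega>. \<bar>X \<omega>\<bar> * ln ((X \<omega>)\<^sup>2)) (sqrt (2 / pi) * (ln 2 - euler_mascheroni))"
    by (rule T[of "\<lambda>x. \<bar>x\<bar> * ln (x\<^sup>2)", OF _ std_normal_abs_ln_sq]) measurable
  show "has_bochner_integral M (\<lambda>\<omega>. X \<omega> * ln ((X \<omega>)\<^sup>2)) 0"
    by (rule T[of "\<lambda>x. x * ln (x\<^sup>2)", OF _ std_normal_mult_ln_sq]) measurable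
qed

text \<open>Expand the products and insert the raw moments. Odd moments remove the mixed terms in
  \<Theta>, and the variance of |X| is 1 - 2/pi.\<close>

lemma centred_moments:
  assumes D: "distributed M lborel X std_normal_density"
  shows "has_bochner_integral M (\<lambda>\<omega>. news \<Theta> \<xi> (X \<omega>)) 0"
    and "has_bochner_integral M (\<lambda>\<omega>. centred_ln_sq (X \<omega>)) 0"
    and "has_bochner_integral M (\<lambda>\<omega>. (news \<Theta> \<xi> (X \<omega>))\<^sup>2) (\<Theta>\<^sup>2 + \<xi>\<^sup>2 * (1 - 2 / pi))"
    and "has_bochner_integral M (\<lambda>\<omega>. news \<Theta> \<xi> (X \<omega>) * centred_ln_sq (X \<omega>)) (2 * \<xi> * ln 2 * sqrt (2 / pi))"
    and "has_bochner_integral M (\<lambda>\<omega>. (centred_ln_sq (X \<omega>))\<^sup>2) (pi\<^sup>2 / 2)"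
proof -
  note m = std_normal_moments[OF D]
  have one: "has_bochner_integral M (\<lambda>\<omega>. c) c" for c :: real
    by (simp add: has_bochner_integral_iff prob_space)
  let ?c = "sqrt (2 / pi)"
  have c2: "?c * ?c = 2 / pi" by simp
  have "has_bochner_integral M (\<lambda>\<omega>. \<Theta> * X \<omega> + \<xi> * (\<bar>X \<omega>\<bar> - ?c)) (\<Theta> * 0 + \<xi> * (?c - ?c))"
    by (intro m one has_bochner_integral_add has_bochner_integral_diff has_bochner_integral_mult_right)
  then show 1: "has_bochner_integral M (\<lambda>\<omega>. news \<Theta> \<xi> (X \<omega>)) 0" by (simp add: news_def)
  have "has_bochner_integral M (\<lambda>\<omega>. ln ((X \<omega>)\<^sup>2) - mean_ln_sq) (mean_ln_sq - mean_ln_sq)"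
    by (intro m one has_bochner_integral_diff)
  then show 2: "has_bochner_integral M (\<lambda>\<omega>. centred_ln_sq (X \<omega>)) 0" by (simp add: centred_ln_sq_def)
  have "has_bochner_integral M (\<lambda>\<omega>. \<Theta>\<^sup>2 * (X \<omega>)\<^sup>2 + (2 * \<Theta> * \<xi>) * (X \<omega> * \<bar>X \<omega>\<bar> - ?c * X \<omega>)
       + \<xi>\<^sup>2 * ((X \<omega>)\<^sup>2 - 2 * ?c * \<bar>X \<omega>\<bar> + ?c * ?c))
      (\<Theta>\<^sup>2 * 1 + (2 * \<Theta> * \<xi>) * (0 - ?c * 0) + \<xi>\<^sup>2 * (1 - 2 * ?c * ?c + ?c * ?c))"
    by (intro m one has_bochner_integral_add has_bochner_integral_diff has_bochner_integral_mult_right)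
  moreover have "(\<lambda>\<omega>. \<Theta>\<^sup>2 * (X \<omega>)\<^sup>2 + (2 * \<Theta> * \<xi>) * (X \<omega> * \<bar>X \<omega>\<bar> - ?c * X \<omega>)
       + \<xi>\<^sup>2 * ((X \<omega>)\<^sup>2 - 2 * ?c * \<bar>X \<omega>\<bar> + ?c * ?c)) = (\<lambda>\<omega>. (news \<Theta> \<xi> (X \<omega>))\<^sup>2)"
  proof
    fix \<omega>
    have "(X \<omega>)\<^sup>2 = \<bar>X \<omega>\<bar> * \<bar>X \<omega>\<bar>" by (simp add: power2_eq_square)
    then show "\<Theta>\<^sup>2 * (X \<omega>)\<^sup>2 + (2 * \<Theta> * \<xi>) * (X \<omega> * \<bar>X \<omega>\<bar> - ?c * X \<omega>)
       + \<xi>\<^sup>2 * ((X \<omega>)\<^sup>2 - 2 * ?c * \<bar>X \<omega>\<bar> + ?c * ?c) = (news \<Theta> \<xi> (X \<omega>))\<^sup>2"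
      unfolding news_def by algebra
  qed
  moreover have "\<Theta>\<^sup>2 * 1 + (2 * \<Theta> * \<xi>) * (0 - ?c * 0) + \<xi>\<^sup>2 * (1 - 2 * ?c * ?c + ?c * ?c) =
      \<Theta>\<^sup>2 + \<xi>\<^sup>2 * (1 - 2 / pi)"
    using c2 by (simp add: algebra_simps)
  ultimately show "has_bochner_integral M (\<lambda>\<omega>. (news \<Theta> \<xi> (X \<omega>))\<^sup>2) (\<Theta>\<^sup>2 + \<xi>\<^sup>2 * (1 - 2 / pi))"
    by (simp only:)
  \<comment> \<open>Euler's constant cancels between E |X| ln X^2 and E |X| E ln X^2, leaving sqrt
    (2/pi) times 2 ln 2.\<close>
  have "has_bochner_integral M (\<lambda>\<omega>. \<Theta> * (X \<omega> * ln ((X \<omega>)\<^sup>2)) + \<xi> * (\<bar>X \<omega>\<bar> * ln ((X \<omega>)\<^sup>2) - ?c * ln ((X \<omega>)\<^sup>2))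
       - mean_ln_sq * news \<Theta> \<xi> (X \<omega>))
      (\<Theta> * 0 + \<xi> * (?c * (ln 2 - euler_mascheroni) - ?c * mean_ln_sq) - mean_ln_sq * 0)"
    by (intro m one 1 has_bochner_integral_add has_bochner_integral_diff has_bochner_integral_mult_right)
  moreover have "(\<lambda>\<omega>. \<Theta> * (X \<omega> * ln ((X \<omega>)\<^sup>2)) + \<xi> * (\<bar>X \<omega>\<bar> * ln ((X \<omega>)\<^sup>2) - ?c * ln ((X \<omega>)\<^sup>2))
       - mean_ln_sq * news \<Theta> \<xi> (X \<omega>)) = (\<lambda>\<omega>. news \<Theta> \<xi> (X \<omega>) * centred_ln_sq (X \<omega>))"
    by (auto simp: news_def centred_ln_sq_def algebra_simps)
  ultimately show "has_bochner_integral M (\<lambda>\<omega>. news \<Theta> \<xi> (X \<omega>) * centred_ln_sq (X \<omega>)) (2 * \<xi> * ln 2 * sqrt (2 / pi))"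
    by (simp add: algebra_simps)
  have "has_bochner_integral M (\<lambda>\<omega>. (ln ((X \<omega>)\<^sup>2))\<^sup>2 - 2 * mean_ln_sq * ln ((X \<omega>)\<^sup>2) + mean_ln_sq\<^sup>2)
      (pi\<^sup>2 / 2 + mean_ln_sq\<^sup>2 - 2 * mean_ln_sq * mean_ln_sq + mean_ln_sq\<^sup>2)"
    by (intro m one has_bochner_integral_add has_bochner_integral_diff has_bochner_integral_mult_right)
  moreover have "(\<lambda>\<omega>. (ln ((X \<omega>)\<^sup>2))\<^sup>2 - 2 * mean_ln_sq * ln ((X \<omega>)\<^sup>2) + mean_ln_sq\<^sup>2) = (\<lambda>\<omega>. (centred_ln_sq (X \<omega>))\<^sup>2)"
    by (auto simp: centred_ln_sq_def power2_eq_square algebra_simps)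
  moreover have "pi\<^sup>2 / 2 + mean_ln_sq\<^sup>2 - 2 * mean_ln_sq * mean_ln_sq + mean_ln_sq\<^sup>2 = pi\<^sup>2 / 2"
    by (simp add: power2_eq_square)
  ultimately show "has_bochner_integral M (\<lambda>\<omega>. (centred_ln_sq (X \<omega>))\<^sup>2) (pi\<^sup>2 / 2)" by (simp only:)
qed

lemma indep_vars_mult_has_bochner_integral:
  fixes X :: "'p \<Rightarrow> 'a \<Rightarrow> real" and f h :: "real \<Rightarrow> real"
  assumes X: "indep_vars (\<lambda>_. borel) X UNIV" and "p \<noteq> q"
    and [measurable]: "f \<in> borel_measurable borel" "h \<in> borel_measurable borel"
    and f: "has_bochner_integral M (\<lambda>\<omega>. f (X p \<omega>)) a" and h: "has_bochner_integral M (\<lambda>\<omega>. h (X q \<omega>)) b"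
  shows "has_bochner_integral M (\<lambda>\<omega>. f (X p \<omega>) * h (X q \<omega>)) (a * b)"
proof -
  have "indep_vars (\<lambda>_. borel) (\<lambda>r \<omega>. (if r = p then f else h) (X r \<omega>)) {p, q}"
    by (rule indep_vars_compose2[OF indep_vars_subset[OF X]]) auto
  note I = indep_vars_lebesgue_integral[OF _ this] indep_vars_integrable[OF _ this]
  have "integrable M (\<lambda>\<omega>. (if r = p then f else h) (X r \<omega>))" if "r \<in> {p, q}" for r
    using that f h by (auto simp: has_bochner_integral_iff)
  then show ?thesis using I f h \<open>p \<noteq> q\<close> by (simp add: has_bochner_integral_iff)
qed

end


section \<open>Covariances of moving averages of the innovations\<close>

text \<open>Independence over all pairs of time and site, with standard normal margins, expresses
  that the innovation vectors are i.i.d. N(0, I).\<close>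

locale egarch_innovations = prob_space M for M :: "'a measure" +
  fixes \<epsilon> :: "int \<Rightarrow> 'a \<Rightarrow> real^'n"
    and \<Theta> \<xi> :: real
  assumes indep: "indep_vars (\<lambda>_. borel) (\<lambda>(t, i) \<omega>. \<epsilon> t \<omega> $ i) UNIV"
    and normal: "\<And>t i. distributed M lborel (\<lambda>\<omega>. \<epsilon> t \<omega> $ i) std_normal_density"
begin

definition c_g :: real where "c_g = \<Theta>\<^sup>2 + \<xi>\<^sup>2 * (1 - 2 / pi)"

definition \<kappa> :: real where "\<kappa> = 2 * \<xi> * ln 2 * sqrt (2 / pi)"

text \<open>The centred contribution of the innovations of one time point: \<open>A\<close> weights
  the news impact, \<open>B\<close> the centred log square.\<close>

definition shock :: "real^'n^'n \<Rightarrow> real^'n^'n \<Rightarrow> int \<Rightarrow> 'a \<Rightarrow> real^'n" where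
  "shock A B t \<omega> = A *v egarch_g \<Theta> \<xi> (\<epsilon> t \<omega>) + B *v (vln_sq (\<epsilon> t \<omega>) - mean_ln_sq *\<^sub>R (\<chi> i. 1))"

text \<open>The cross-covariance matrix of \<open>shock A B t\<close> and
  \<open>shock C D t\<close>; see \<open>shock_product\<close>.\<close>

definition shock_cov :: "real^'n^'n \<Rightarrow> real^'n^'n \<Rightarrow> real^'n^'n \<Rightarrow> real^'n^'n \<Rightarrow> real^'n^'n" where
  "shock_cov A B C D = c_g *\<^sub>R (A ** transpose C) + \<kappa> *\<^sub>R (A ** transpose D + B ** transpose C)
    + (pi\<^sup>2 / 2) *\<^sub>R (B ** transpose D)"

lemma shock_nth: "shock A B t \<omega> $ i =
    (\<Sum>j\<in>UNIV. A $ i $ j * news \<Theta> \<xi> (\<epsilon> t \<omega> $ j) + B $ i $ j * centred_ln_sq (\<epsilon> t \<omega> $ j))"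
  by (simp add: shock_def matrix_vector_mult_def egarch_g_def vln_sq_def news_def centred_ln_sq_def
      sum.distrib)

lemma shock_cov_nth: "shock_cov A B C D $ i $ k =
    (\<Sum>j\<in>UNIV. A $ i $ j * C $ k $ j * c_g + (A $ i $ j * D $ k $ j + B $ i $ j * C $ k $ j) * \<kappa>
      + B $ i $ j * D $ k $ j * (pi\<^sup>2 / 2))"
proof -
  define v :: real where "v = pi\<^sup>2 / 2"
  show ?thesis
    unfolding shock_cov_def v_def[symmetric]
    by (simp add: matrix_matrix_mult_def transpose_def sum.distrib distrib_right
        sum_distrib_right[symmetric]) (simp add: algebra_simps)
qed

lemma noise_mean:
  "has_bochner_integral M (\<lambda>\<omega>. a * news \<Theta> \<xi> (\<epsilon> t \<omega> $ j) + b * centred_ln_sq (\<epsilon> t \<omega> $ j)) 0"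
proof -
  have "has_bochner_integral M (\<lambda>\<omega>. a * news \<Theta> \<xi> (\<epsilon> t \<omega> $ j) + b * centred_ln_sq (\<epsilon> t \<omega> $ j)) (a * 0 + b * 0)"
    by (intro has_bochner_integral_add has_bochner_integral_mult_right centred_moments normal)
  then show ?thesis by simp
qed

text \<open>For the same time and site the product expands into the three second moments; otherwise
  the factors are independent with mean zero.\<close>

lemma noise_product:
  "has_bochner_integral M (\<lambda>\<omega>. (a * news \<Theta> \<xi> (\<epsilon> t \<omega> $ j) + b * centred_ln_sq (\<epsilon> t \<omega> $ j))
      * (c * news \<Theta> \<xi> (\<epsilon> s \<omega> $ k) + d * centred_ln_sq (\<epsilon> s \<omega> $ k)))
    (if s = t then if j = k then a * c * c_g + (a * d + b * c) * \<kappa> + b * d * (pi\<^sup>2 / 2) else 0 else 0)"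
proof (cases "(t, j) = (s, k)")
  case True
  have "has_bochner_integral M (\<lambda>\<omega>. a * c * (news \<Theta> \<xi> (\<epsilon> t \<omega> $ j))\<^sup>2
      + (a * d + b * c) * (news \<Theta> \<xi> (\<epsilon> t \<omega> $ j) * centred_ln_sq (\<epsilon> t \<omega> $ j))
      + b * d * (centred_ln_sq (\<epsilon> t \<omega> $ j))\<^sup>2)
    (a * c * c_g + (a * d + b * c) * \<kappa> + b * d * (pi\<^sup>2 / 2))"
    unfolding c_g_def \<kappa>_def
    by (intro has_bochner_integral_add has_bochner_integral_mult_right centred_moments normal)
  moreover have "(\<lambda>\<omega>. a * c * (news \<Theta> \<xi> (\<epsilon> t \<omega> $ j))\<^sup>2
      + (a * d + b * c) * (news \<Theta> \<xi> (\<epsilon> t \<omega> $ j) * centred_ln_sq (\<epsilon> t \<omega> $ j))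
      + b * d * (centred_ln_sq (\<epsilon> t \<omega> $ j))\<^sup>2)
    = (\<lambda>\<omega>. (a * news \<Theta> \<xi> (\<epsilon> t \<omega> $ j) + b * centred_ln_sq (\<epsilon> t \<omega> $ j))
      * (c * news \<Theta> \<xi> (\<epsilon> t \<omega> $ j) + d * centred_ln_sq (\<epsilon> t \<omega> $ j)))"
    by (simp add: power2_eq_square algebra_simps)
  ultimately show ?thesis using True by simp
next
  case False
  have "has_bochner_integral M (\<lambda>\<omega>. (a * news \<Theta> \<xi> (\<epsilon> t \<omega> $ j) + b * centred_ln_sq (\<epsilon> t \<omega> $ j))
      * (c * news \<Theta> \<xi> (\<epsilon> s \<omega> $ k) + d * centred_ln_sq (\<epsilon> s \<omega> $ k))) (0 * 0)"
    using indep_vars_mult_has_bochner_integral[OF indep False,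
        of "\<lambda>x. a * news \<Theta> \<xi> x + b * centred_ln_sq x" "\<lambda>x. c * news \<Theta> \<xi> x + d * centred_ln_sq x" 0 0]
      noise_mean by simp
  then show ?thesis using False by auto
qed

lemma shock_mean: "has_bochner_integral M (\<lambda>\<omega>. shock A B t \<omega> $ i) 0"
proof -
  have "has_bochner_integral M (\<lambda>\<omega>. shock A B t \<omega> $ i) (\<Sum>j\<in>(UNIV :: 'n set). 0)"
    unfolding shock_nth by (intro has_bochner_integral_sum noise_mean)
  then show ?thesis by simp
qed

lemma shock_product:
  "has_bochner_integral M (\<lambda>\<omega>. shock A B t \<omega> $ i * shock C D s \<omega> $ k)
    (if s = t then shock_cov A B C D $ i $ k else 0)"
proof -
  have "has_bochner_integral M (\<lambda>\<omega>. shock A B t \<omega> $ i * shock C D s \<omega> $ k)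
    (\<Sum>j\<in>UNIV. \<Sum>l\<in>UNIV. if s = t then if j = l then A $ i $ j * C $ k $ l * c_g
      + (A $ i $ j * D $ k $ l + B $ i $ j * C $ k $ l) * \<kappa> + B $ i $ j * D $ k $ l * (pi\<^sup>2 / 2) else 0 else 0)"
    unfolding shock_nth sum_product by (intro has_bochner_integral_sum noise_product)
  moreover have "(\<Sum>j\<in>UNIV. \<Sum>l\<in>UNIV. if s = t then if j = l then A $ i $ j * C $ k $ l * c_g
      + (A $ i $ j * D $ k $ l + B $ i $ j * C $ k $ l) * \<kappa> + B $ i $ j * D $ k $ l * (pi\<^sup>2 / 2) else 0 else 0)
      = (if s = t then shock_cov A B C D $ i $ k else 0)"
    by (cases "s = t") (simp_all add: shock_cov_nth)
  ultimately show ?thesis by (simp only:)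
qed

text \<open>A vector moving average of order one. The product of two residuals has four terms, and
  only those whose shocks share a time point have nonzero mean: two at lag 0, one at lag 1, none
  beyond.\<close>

lemma ma1_moments:
  fixes \<nu> :: "int \<Rightarrow> 'a \<Rightarrow> real^'n"
  assumes meas: "\<And>t. \<nu> t \<in> borel_measurable M"
    and ma: "\<And>t. AE \<omega> in M. \<nu> t \<omega> = \<mu> + shock A B t \<omega> + shock C D (t - 1) \<omega>"
  shows "integrable M (\<nu> t)"
    and "integrable M (\<lambda>\<omega>. (\<nu> t \<omega> $ i)\<^sup>2)"
    and "integral\<^sup>L M (\<nu> t) = \<mu>"
    and "vcov M (\<nu> t) (\<nu> t) = shock_cov A B A B + shock_cov C D C D"
    and "vcov M (\<nu> t) (\<nu> (t - 1)) = shock_cov C D A B"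
    and "s > 1 \<Longrightarrow> vcov M (\<nu> t) (\<nu> (t - int s)) = 0"
proof -
  let ?R = "\<lambda>t \<omega> i. shock A B t \<omega> $ i + shock C D (t - 1) \<omega> $ i"
  have mi: "(\<lambda>\<omega>. \<nu> t \<omega> $ i) \<in> borel_measurable M" for t i
    by (rule borel_measurable_vec_nth[OF meas])
  have comp: "AE \<omega> in M. \<mu> $ i + ?R t \<omega> i = \<nu> t \<omega> $ i" for t i
    using ma[of t] by eventually_elim simp
  have Rm: "has_bochner_integral M (\<lambda>\<omega>. ?R t \<omega> i) 0" for t i
    using has_bochner_integral_add[OF shock_mean shock_mean] by simp
  have const: "has_bochner_integral M (\<lambda>\<omega>. x) x" for x :: real
    by (simp add: has_bochner_integral_iff prob_space)
  have mean: "has_bochner_integral M (\<lambda>\<omega>. \<nu> t \<omega> $ i) (\<mu> $ i)" for t i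
  proof (rule has_bochner_integralI_AE[OF _ mi comp])
    show "has_bochner_integral M (\<lambda>\<omega>. \<mu> $ i + ?R t \<omega> i) (\<mu> $ i)"
      using has_bochner_integral_add[OF const Rm] by simp
  qed
  then have "has_bochner_integral M (\<nu> t) \<mu>" by (rule has_bochner_integral_vecI)
  then show "integrable M (\<nu> t)" "integral\<^sup>L M (\<nu> t) = \<mu>" by (simp_all add: has_bochner_integral_iff)
  have RR: "has_bochner_integral M (\<lambda>\<omega>. ?R t \<omega> i * ?R s \<omega> k)
      ((if s = t then shock_cov A B A B $ i $ k else 0) + (if s = t - 1 then shock_cov C D A B $ i $ k else 0)
       + ((if s - 1 = t then shock_cov A B C D $ i $ k else 0) + (if s - 1 = t - 1 then shock_cov C D C D $ i $ k else 0)))"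
    for t s i k
    unfolding distrib_left distrib_right
    by (intro has_bochner_integral_add shock_product)
  have cov: "vcov M (\<nu> t) (\<nu> s) $ i $ k =
      (if s = t then shock_cov A B A B $ i $ k else 0) + (if s = t - 1 then shock_cov C D A B $ i $ k else 0)
       + ((if s - 1 = t then shock_cov A B C D $ i $ k else 0) + (if s - 1 = t - 1 then shock_cov C D C D $ i $ k else 0))"
    for t s i k
  proof -
    have E: "expectation (\<lambda>\<omega>. \<nu> t \<omega> $ i) = \<mu> $ i" for t i
      using mean by (simp add: has_bochner_integral_iff)
    have "vcov M (\<nu> t) (\<nu> s) $ i $ k = expectation (\<lambda>\<omega>. (\<nu> t \<omega> $ i - \<mu> $ i) * (\<nu> s \<omega> $ k - \<mu> $ k))"
      by (simp add: vcov_def E)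
    also have "\<dots> = expectation (\<lambda>\<omega>. ?R t \<omega> i * ?R s \<omega> k)"
    proof (rule integral_cong_AE)
      show "(\<lambda>\<omega>. ?R t \<omega> i * ?R s \<omega> k) \<in> borel_measurable M"
        by (rule borel_measurable_has_bochner_integral[OF RR])
      show "AE \<omega> in M. (\<nu> t \<omega> $ i - \<mu> $ i) * (\<nu> s \<omega> $ k - \<mu> $ k) = ?R t \<omega> i * ?R s \<omega> k"
        using ma[of t] ma[of s] by eventually_elim simp
    qed (intro borel_measurable_times borel_measurable_diff borel_measurable_const mi)
    also have "\<dots> = (if s = t then shock_cov A B A B $ i $ k else 0) + (if s = t - 1 then shock_cov C D A B $ i $ k else 0)
       + ((if s - 1 = t then shock_cov A B C D $ i $ k else 0) + (if s - 1 = t - 1 then shock_cov C D C D $ i $ k else 0))"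
      by (rule has_bochner_integral_integral_eq[OF RR])
    finally show ?thesis .
  qed
  show "vcov M (\<nu> t) (\<nu> t) = shock_cov A B A B + shock_cov C D C D"
    "vcov M (\<nu> t) (\<nu> (t - 1)) = shock_cov C D A B"
    "s > 1 \<Longrightarrow> vcov M (\<nu> t) (\<nu> (t - int s)) = 0"
    by (simp_all add: vec_eq_iff cov)
  show "integrable M (\<lambda>\<omega>. (\<nu> t \<omega> $ i)\<^sup>2)"
  proof (rule integrable_cong_AE_imp)
    have "integrable M (\<lambda>\<omega>. (\<mu> $ i)\<^sup>2 + 2 * \<mu> $ i * ?R t \<omega> i + ?R t \<omega> i * ?R t \<omega> i)"
      by (rule integrable.intros, rule has_bochner_integral_add[OF has_bochner_integral_add[OF const
          has_bochner_integral_mult_right[OF Rm]] RR])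
    moreover have "(\<mu> $ i + r)\<^sup>2 = (\<mu> $ i)\<^sup>2 + 2 * \<mu> $ i * r + r * r" for r
      by (simp add: power2_eq_square algebra_simps)
    ultimately show "integrable M (\<lambda>\<omega>. (\<mu> $ i + ?R t \<omega> i)\<^sup>2)" by (simp only:)
    show "AE \<omega> in M. (\<mu> $ i + ?R t \<omega> i)\<^sup>2 = (\<nu> t \<omega> $ i)\<^sup>2"
      using comp[of i t] by eventually_elim simp
  qed (intro borel_measurable_power mi)
qed

end

section \<open>The log-square process\<close>

context egarch_innovations
begin

lemma innovation_nth_measurable: "(\<lambda>\<omega>. \<epsilon> t \<omega> $ i) \<in> borel_measurable M"
  using distributed_measurable[OF normal] by simp

lemma egarch_g_measurable: "(\<lambda>\<omega>. egarch_g \<Theta> \<xi> (\<epsilon> t \<omega>)) \<in> borel_measurable M"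
  by (rule borel_measurable_vecI, unfold egarch_g_def vec_lambda_beta)
    (use innovation_nth_measurable in measurable)

lemma egarch_Delta_measurable: "egarch_Delta S W1 \<alpha> \<rho>0 \<rho>1 \<Theta> \<xi> \<epsilon> t \<in> borel_measurable M"
  unfolding egarch_Delta_def[abs_def]
  by (intro borel_measurable_matrix_vector_mult borel_measurable_add borel_measurable_const
      borel_measurable_const_scaleR egarch_g_measurable)

text \<open>The moving-average form of the residual holds only almost surely, so measurability is
  proved from the definition of \<open>egarch_Y\<close> itself.\<close>

lemma vln_sq_egarch_Y_measurable:
  "(\<lambda>\<omega>. vln_sq (egarch_Y S W1 \<alpha> \<rho>0 \<rho>1 lam1 \<Theta> \<xi> \<epsilon> t \<omega>)) \<in> borel_measurable M"
proof (rule borel_measurable_vecI)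
  fix i
  have [measurable]: "(\<lambda>\<omega>. \<epsilon> t \<omega> $ i) \<in> borel_measurable M" by (rule innovation_nth_measurable)
  have [measurable]: "(\<lambda>\<omega>. (\<Sum>v. (lam1 ^ v) *\<^sub>R
      (matpow S v *v egarch_Delta S W1 \<alpha> \<rho>0 \<rho>1 \<Theta> \<xi> \<epsilon> (t - int v) \<omega>)) $ i) \<in> borel_measurable M"
    by (intro borel_measurable_vec_nth borel_measurable_suminf borel_measurable_const_scaleR
        borel_measurable_matrix_vector_mult egarch_Delta_measurable)
  show "(\<lambda>\<omega>. vln_sq (egarch_Y S W1 \<alpha> \<rho>0 \<rho>1 lam1 \<Theta> \<xi> \<epsilon> t \<omega>) $ i) \<in> borel_measurable M"
    unfolding vln_sq_def egarch_Y_def vec_lambda_beta by measurable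
qed

text \<open>The normal law has no atoms. Zeros must be excluded because \<open>ln 0 = 0\<close>
  breaks the rule for the logarithm of a product.\<close>

lemma AE_innovation_nonzero: "AE \<omega> in M. \<forall>i. \<epsilon> t \<omega> $ i \<noteq> 0"
proof -
  have "AE \<omega> in M. \<epsilon> t \<omega> $ i \<noteq> 0" for i
  proof -
    have "AE x in distr M lborel (\<lambda>\<omega>. \<epsilon> t \<omega> $ i). x \<noteq> 0"
      unfolding distributed_distr_eq_density[OF normal]
      by (subst AE_density) (use AE_lborel_singleton[of "0::real"] in \<open>auto elim: eventually_mono\<close>)
    then show ?thesis
      by (subst (asm) AE_distr_iff) (use distributed_measurable[OF normal] in auto)
  qed
  then show ?thesis by (simp add: AE_all_countable)
qed

text \<open>The v-th term is a power of \<open>lam1 *\<^sub>R S\<close>, with summable bound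
  \<open>K v\<close>, applied to a vector whose norm is at most \<open>Z v\<close>. The expectation
  of \<open>Z v\<close> does not depend on \<open>v\<close>, so \<open>AE_summable_mult\<close>
  applies.\<close>

lemma AE_summable_egarch_Delta:
  assumes rad: "spectral_radius (lam1 *\<^sub>R S) < 1"
  shows "AE \<omega> in M. summable (\<lambda>v. lam1 ^ v *\<^sub>R
    (matpow S v *v egarch_Delta S W1 \<alpha> \<rho>0 \<rho>1 \<Theta> \<xi> \<epsilon> (t - int v) \<omega>))"
proof -
  let ?\<Delta> = "egarch_Delta S W1 \<alpha> \<rho>0 \<rho>1 \<Theta> \<xi> \<epsilon>"
  define N where "N t \<omega> = (\<Sum>j\<in>UNIV. \<bar>news \<Theta> \<xi> (\<epsilon> t \<omega> $ j)\<bar>)" for t \<omega>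
  have N0: "0 \<le> N t \<omega>" for t \<omega> by (simp add: N_def sum_nonneg)
  have gN: "norm (egarch_g \<Theta> \<xi> (\<epsilon> t \<omega>)) \<le> N t \<omega>" for t \<omega>
    using norm_le_l1_cart[of "egarch_g \<Theta> \<xi> (\<epsilon> t \<omega>)"] by (simp add: N_def egarch_g_def news_def)
  obtain K where K: "summable K" "\<And>k. 0 \<le> K k" "\<And>k x. norm (matpow (lam1 *\<^sub>R S) k *v x) \<le> K k * norm x"
    using matpow_summable_bound[OF rad] by metis
  obtain s where s: "\<And>x. norm (S *v x) \<le> norm x * s" "s > 0"
    using bounded_linear.pos_bounded[OF matrix_vector_mul_bounded_linear[of S]] by blast
  obtain w where w: "\<And>x. norm (W1 *v x) \<le> norm x * w" "w > 0"
    using bounded_linear.pos_bounded[OF matrix_vector_mul_bounded_linear[of W1]] by blast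
  define Z where "Z v \<omega> = (norm \<alpha> + \<bar>\<rho>0\<bar> * (N (t - int v) \<omega> * w) + \<bar>\<rho>1\<bar> * N (t - int v - 1) \<omega>) * s" for v \<omega>
  have \<Delta>Z: "norm (?\<Delta> (t - int v) \<omega>) \<le> Z v \<omega>" for v \<omega>
  proof -
    let ?u = "t - int v"
    have "norm (\<alpha> + \<rho>0 *\<^sub>R (W1 *v egarch_g \<Theta> \<xi> (\<epsilon> ?u \<omega>)) + \<rho>1 *\<^sub>R egarch_g \<Theta> \<xi> (\<epsilon> (?u - 1) \<omega>))
      \<le> norm \<alpha> + \<bar>\<rho>0\<bar> * norm (W1 *v egarch_g \<Theta> \<xi> (\<epsilon> ?u \<omega>)) + \<bar>\<rho>1\<bar> * norm (egarch_g \<Theta> \<xi> (\<epsilon> (?u - 1) \<omega>))"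
      by (rule norm_triangle_le, rule add_mono, rule norm_triangle_le) auto
    also have "\<dots> \<le> norm \<alpha> + \<bar>\<rho>0\<bar> * (N ?u \<omega> * w) + \<bar>\<rho>1\<bar> * N (?u - 1) \<omega>"
      using w(2) by (intro add_mono mult_left_mono order_refl gN order_trans[OF w(1)] mult_right_mono) auto
    finally show ?thesis
      unfolding egarch_Delta_def Z_def
      using s by (intro order_trans[OF s(1)] mult_right_mono) auto
  qed
  \<comment> \<open>Written as an integral against the density, so that it is visibly the same
    constant for all times and sites.\<close>
  define e where "e = (\<integral>x. std_normal_density x * \<bar>news \<Theta> \<xi> x\<bar> \<partial>lborel)"
  have news_abs: "has_bochner_integral M (\<lambda>\<omega>. \<bar>news \<Theta> \<xi> (\<epsilon> t \<omega> $ j)\<bar>) e" for t j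
    using distributed_integral[OF normal, of "\<lambda>x. \<bar>news \<Theta> \<xi> x\<bar>" t j]
      integrable_abs[OF integrable.intros[OF centred_moments(1)[OF normal]], of \<Theta> \<xi> t j]
    by (simp add: has_bochner_integral_iff e_def)
  have N: "has_bochner_integral M (N t) (real CARD('n) * e)" for t
    using has_bochner_integral_sum[of UNIV M "\<lambda>j \<omega>. \<bar>news \<Theta> \<xi> (\<epsilon> t \<omega> $ j)\<bar>" "\<lambda>_. e"] news_abs
    by (simp add: N_def[abs_def])
  have const: "has_bochner_integral M (\<lambda>\<omega>. x) x" for x :: real
    by (simp add: has_bochner_integral_iff prob_space)
  have Z: "has_bochner_integral M (Z v) ((norm \<alpha> + \<bar>\<rho>0\<bar> * (real CARD('n) * e * w) + \<bar>\<rho>1\<bar> * (real CARD('n) * e)) * s)" for v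
    unfolding Z_def[abs_def]
    by (intro has_bochner_integral_mult_left has_bochner_integral_add has_bochner_integral_mult_right const N)
  have "AE \<omega> in M. summable (\<lambda>v. K v * Z v \<omega>)"
  proof (rule AE_summable_mult[OF _ _ _ K(1,2)])
    show "0 \<le> Z v \<omega>" for v \<omega> using s(2) w(2) N0 by (simp add: Z_def)
  qed (use Z in \<open>auto simp: has_bochner_integral_iff\<close>)
  then show ?thesis
  proof eventually_elim
    fix \<omega> assume sum: "summable (\<lambda>v. K v * Z v \<omega>)"
    show "summable (\<lambda>v. lam1 ^ v *\<^sub>R (matpow S v *v ?\<Delta> (t - int v) \<omega>))"
    proof (rule summable_comparison_test'[OF sum])
      fix v :: nat
      have "lam1 ^ v *\<^sub>R (matpow S v *v ?\<Delta> (t - int v) \<omega>) = matpow (lam1 *\<^sub>R S) v *v ?\<Delta> (t - int v) \<omega>"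
        by (simp add: matpow_scaleR scaleR_matrix_vector_assoc)
      also have "norm \<dots> \<le> K v * norm (?\<Delta> (t - int v) \<omega>)" by (rule K(3))
      also have "\<dots> \<le> K v * Z v \<omega>" by (intro mult_left_mono \<Delta>Z K(2))
      finally show "norm (lam1 ^ v *\<^sub>R (matpow S v *v ?\<Delta> (t - int v) \<omega>)) \<le> K v * Z v \<omega>" .
    qed
  qed
qed

section \<open>Recursion for the log squares and the residual\<close>

lemma AE_log_square_recursion:
  fixes \<alpha> :: "real^'n" and S W1 :: "real^'n^'n" and \<rho>0 \<rho>1 lam1 :: real
  assumes rad: "spectral_radius (lam1 *\<^sub>R S) < 1"
  defines "Y \<equiv> egarch_Y S W1 \<alpha> \<rho>0 \<rho>1 lam1 \<Theta> \<xi> \<epsilon>"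
    and "\<Delta> \<equiv> egarch_Delta S W1 \<alpha> \<rho>0 \<rho>1 \<Theta> \<xi> \<epsilon>"
  shows "AE \<omega> in M. vln_sq (Y t \<omega>) - lam1 *\<^sub>R (S *v vln_sq (Y (t - 1) \<omega>)) =
    \<Delta> t \<omega> - lam1 *\<^sub>R (S *v vln_sq (\<epsilon> (t - 1) \<omega>)) + vln_sq (\<epsilon> t \<omega>)"
proof -
  define H where "H t \<omega> = (\<Sum>v. lam1 ^ v *\<^sub>R (matpow S v *v \<Delta> (t - int v) \<omega>))" for t \<omega>
  have lnY: "vln_sq (Y t \<omega>) = vln_sq (\<epsilon> t \<omega>) + H t \<omega>" if "\<forall>i. \<epsilon> t \<omega> $ i \<noteq> 0" for t \<omega>
  proof -
    have "ln ((x * exp (1 / 2 * h))\<^sup>2) = ln (x\<^sup>2) + h" if "x \<noteq> 0" for x h :: real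
      using that by (simp add: power_mult_distrib exp_double[symmetric] ln_mult)
    then show ?thesis
      using that by (simp add: vec_eq_iff vln_sq_def Y_def egarch_Y_def H_def \<Delta>_def)
  qed
  show ?thesis
    using AE_innovation_nonzero[of t] AE_innovation_nonzero[of "t - 1"]
      AE_summable_egarch_Delta[OF rad, of W1 \<alpha> \<rho>0 \<rho>1 t]
      AE_summable_egarch_Delta[OF rad, of W1 \<alpha> \<rho>0 \<rho>1 "t - 1"]
  proof eventually_elim
    fix \<omega>
    assume nz: "\<forall>i. \<epsilon> t \<omega> $ i \<noteq> 0" "\<forall>i. \<epsilon> (t - 1) \<omega> $ i \<noteq> 0"
      and sum: "summable (\<lambda>v. lam1 ^ v *\<^sub>R (matpow S v *v egarch_Delta S W1 \<alpha> \<rho>0 \<rho>1 \<Theta> \<xi> \<epsilon> (t - int v) \<omega>))"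
        "summable (\<lambda>v. lam1 ^ v *\<^sub>R (matpow S v *v egarch_Delta S W1 \<alpha> \<rho>0 \<rho>1 \<Theta> \<xi> \<epsilon> (t - 1 - int v) \<omega>))"
    have L: "bounded_linear (\<lambda>x. lam1 *\<^sub>R (S *v x))"
      by (intro bounded_linear_compose[OF bounded_linear_scaleR_right] matrix_vector_mul_bounded_linear)
    \<comment> \<open>Uses (t - Suc v) = (t - 1) - v: the tail of the series at time t is the image
      of the series at time t - 1 under one bounded linear map, which passes through the
      sum.\<close>
    have step: "lam1 ^ Suc v *\<^sub>R (matpow S (Suc v) *v \<Delta> (t - int (Suc v)) \<omega>) =
        lam1 *\<^sub>R (S *v (lam1 ^ v *\<^sub>R (matpow S v *v \<Delta> (t - 1 - int v) \<omega>)))" for v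
      by (simp add: matrix_vector_mul_assoc[symmetric] matrix_vector_mult_scaleR algebra_simps)
    have "H t \<omega> = \<Delta> t \<omega> + (\<Sum>v. lam1 ^ Suc v *\<^sub>R (matpow S (Suc v) *v \<Delta> (t - int (Suc v)) \<omega>))"
      using suminf_split_head[OF sum(1)] by (simp add: H_def \<Delta>_def)
    also have "\<dots> = \<Delta> t \<omega> + lam1 *\<^sub>R (S *v H (t - 1) \<omega>)"
      unfolding step H_def using bounded_linear.suminf[OF L sum(2)] by (simp add: \<Delta>_def)
    finally have H: "H t \<omega> = \<Delta> t \<omega> + lam1 *\<^sub>R (S *v H (t - 1) \<omega>)" .
    show "vln_sq (Y t \<omega>) - lam1 *\<^sub>R (S *v vln_sq (Y (t - 1) \<omega>)) =
        \<Delta> t \<omega> - lam1 *\<^sub>R (S *v vln_sq (\<epsilon> (t - 1) \<omega>)) + vln_sq (\<epsilon> t \<omega>)"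
      unfolding lnY[OF nz(1)] lnY[OF nz(2)] H
      by (simp add: matrix_vector_right_distrib scaleR_add_right)
  qed
qed

text \<open>Centring both log squares: the mean at time t contributes \<open>mean_ln_sq\<close>
  times the all-ones vector, the one at time t - 1 contributes its image under
  \<open>- lam1 *\<^sub>R S\<close>.\<close>

lemma log_square_residual_shocks:
  "egarch_Delta S W1 \<alpha> \<rho>0 \<rho>1 \<Theta> \<xi> \<epsilon> t \<omega> - lam1 *\<^sub>R (S *v vln_sq (\<epsilon> (t - 1) \<omega>)) + vln_sq (\<epsilon> t \<omega>) =
    (S *v \<alpha> + mean_ln_sq *\<^sub>R ((mat 1 - lam1 *\<^sub>R S) *v (\<chi> i. 1)))
    + shock (\<rho>0 *\<^sub>R (S ** W1)) (mat 1) t \<omega> + shock (\<rho>1 *\<^sub>R S) (- lam1 *\<^sub>R S) (t - 1) \<omega>"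
proof -
  have sc: "(c *\<^sub>R A) *v x = c *\<^sub>R (A *v x)" "A *v (c *\<^sub>R x) = c *\<^sub>R (A *v x)" 
    "(- (c *\<^sub>R A)) *v x = - (c *\<^sub>R (A *v x))" for c and A :: "real^'n^'n" and x

    by (simp_all add: scaleR_matrix_vector_assoc matrix_vector_mult_scaleR)
      (simp add: matrix_vector_mult_def vec_eq_iff sum_negf sum_distrib_left mult.assoc)
  define m where "m = mean_ln_sq"
  show ?thesis
    unfolding egarch_Delta_def shock_def m_def[symmetric]
    by (simp add: sc matrix_vector_right_distrib matrix_vector_mult_diff_distrib
        matrix_vector_mult_diff_rdistrib matrix_vector_mul_assoc scaleR_right_diff_distrib)
qed

end

section \<open>Evaluation of the mean and the covariance matrices\<close>

lemma scaled_matrix_mult: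
  fixes A B :: "real^'n^'n"
  shows "(c *\<^sub>R A) ** B = c *\<^sub>R (A ** B)" "A ** (c *\<^sub>R B) = c *\<^sub>R (A ** B)"
  by (simp_all add: scalar_matrix_assoc[symmetric] matrix_scalar_ac)

lemma transpose_scaleR: "transpose (c *\<^sub>R A) = c *\<^sub>R transpose (A :: real^'n^'m)"
  by (simp add: transpose_def vec_eq_iff)

theorem theorem2:
  fixes M :: "'a measure"
    and \<epsilon> :: "int \<Rightarrow> 'a \<Rightarrow> real^'n"
    and W1 W2 :: "real^'n^'n"
    and \<alpha>1 :: "real^'n"
    and \<rho>0 \<rho>1 lam0 lam1 \<Theta> \<xi> c_g \<kappa> :: real
    and S :: "real^'n^'n"
    and Y \<Delta> \<nu> :: "int \<Rightarrow> 'a \<Rightarrow> real^'n"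
  assumes P: "prob_space M"
    and xi: "\<xi> \<ge> 0" "\<bar>\<Theta>\<bar> < \<xi>"
    and inv: "invertible (mat 1 - lam0 *\<^sub>R W2)"
    and rad1: "spectral_radius (lam1 *\<^sub>R matrix_inv (mat 1 - lam0 *\<^sub>R W2)) < 1"
    and rad0: "spectral_radius (lam0 *\<^sub>R W2) < 1"
    and indep: "prob_space.indep_vars M (\<lambda>_. borel) (\<lambda>(t, i) \<omega>. \<epsilon> t \<omega> $ i) UNIV"
    and normal: "\<And>t i. distributed M lborel (\<lambda>\<omega>. \<epsilon> t \<omega> $ i) std_normal_density"
    and S_def: "S = matrix_inv (mat 1 - lam0 *\<^sub>R W2)"
    and Y_def: "Y = egarch_Y S W1 \<alpha>1 \<rho>0 \<rho>1 lam1 \<Theta> \<xi> \<epsilon>"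
    and Delta_def: "\<Delta> = egarch_Delta S W1 \<alpha>1 \<rho>0 \<rho>1 \<Theta> \<xi> \<epsilon>"
    and nu_def: "\<nu> = (\<lambda>t \<omega>. vln_sq (Y t \<omega>) - lam1 *\<^sub>R (S *v vln_sq (Y (t - 1) \<omega>)))"
    and cg_def: "c_g = \<Theta>\<^sup>2 + \<xi>\<^sup>2 * (1 - 2 / pi)"
    and kappa_def: "\<kappa> = 2 * \<xi> * ln 2 * sqrt (2 / pi)"
  shows "(\<forall>t \<omega>. vln_sq (Y t \<omega>) = lam1 *\<^sub>R (S *v vln_sq (Y (t - 1) \<omega>)) + \<nu> t \<omega>)
     \<and> (\<forall>t. AE \<omega> in M. \<nu> t \<omega> =
        S *v (\<alpha>1 + \<rho>0 *\<^sub>R (W1 *v egarch_g \<Theta> \<xi> (\<epsilon> t \<omega>)) + \<rho>1 *\<^sub>R egarch_g \<Theta> \<xi> (\<epsilon> (t - 1) \<omega>)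
              - lam1 *\<^sub>R vln_sq (\<epsilon> (t - 1) \<omega>)) + vln_sq (\<epsilon> t \<omega>))
     \<and> (\<forall>t. AE \<omega> in M. \<nu> t \<omega> =
        \<Delta> t \<omega> - lam1 *\<^sub>R (S *v vln_sq (\<epsilon> (t - 1) \<omega>)) + vln_sq (\<epsilon> t \<omega>))
     \<and> (\<forall>t. integrable M (\<nu> t) \<and> (\<forall>i. integrable M (\<lambda>\<omega>. (\<nu> t \<omega> $ i)\<^sup>2)))
     \<and> (\<forall>t. integral\<^sup>L M (\<nu> t) =
        S *v \<alpha>1 + (- ln 2 - euler_mascheroni) *\<^sub>R ((mat 1 - lam1 *\<^sub>R S) *v (\<chi> i. 1)))
     \<and> ((\<forall>i. (\<Sum>j\<in>UNIV. W2 $ i $ j) = 1) \<longrightarrow> (\<forall>t. integral\<^sup>L M (\<nu> t) =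
        S *v \<alpha>1 + ((- ln 2 - euler_mascheroni) * (1 - lam1 / (1 - lam0))) *\<^sub>R (\<chi> i. 1)))
     \<and> (\<forall>t. vcov M (\<nu> t) (\<nu> t) =
        (\<rho>0\<^sup>2 * c_g) *\<^sub>R (S ** W1 ** transpose W1 ** transpose S)
        + (pi\<^sup>2 / 2) *\<^sub>R mat 1
        + (\<rho>0 * \<kappa>) *\<^sub>R (S ** W1 + transpose W1 ** transpose S)
        + (\<rho>1\<^sup>2 * c_g + lam1\<^sup>2 * (pi\<^sup>2 / 2) - 2 * \<rho>1 * lam1 * \<kappa>) *\<^sub>R (S ** transpose S))
     \<and> (\<forall>t. vcov M (\<nu> t) (\<nu> (t - 1)) =
        (\<rho>0 * \<rho>1 * c_g - lam1 * \<rho>0 * \<kappa>) *\<^sub>R (S ** transpose W1 ** transpose S)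
        + (\<rho>1 * \<kappa> - lam1 * (pi\<^sup>2 / 2)) *\<^sub>R S)
     \<and> (\<forall>t s. s > 1 \<longrightarrow> vcov M (\<nu> t) (\<nu> (t - int s)) = 0)"
proof -
  interpret P: prob_space M by (rule P)
  interpret E: egarch_innovations M \<epsilon> \<Theta> \<xi>
    by unfold_locales (use indep normal in auto)
  have cg: "E.c_g = c_g" and kp: "E.\<kappa> = \<kappa>"
    by (simp_all add: E.c_g_def E.\<kappa>_def cg_def kappa_def)
  let ?\<mu> = "S *v \<alpha>1 + (- ln 2 - euler_mascheroni) *\<^sub>R ((mat 1 - lam1 *\<^sub>R S) *v (\<chi> i. 1))"
  \<comment> \<open>Current shocks carry the weights \<open>?A\<close> and the identity, lagged
    shocks the weights \<open>?C\<close> and \<open>?D\<close>.\<close>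
  let ?A = "\<rho>0 *\<^sub>R (S ** W1)" and ?C = "\<rho>1 *\<^sub>R S" and ?D = "- lam1 *\<^sub>R S"
  have meas: "\<nu> t \<in> borel_measurable M" for t
    unfolding nu_def Y_def
    by (intro borel_measurable_diff borel_measurable_const_scaleR borel_measurable_matrix_vector_mult
        E.vln_sq_egarch_Y_measurable)
  have res: "AE \<omega> in M. \<nu> t \<omega> = \<Delta> t \<omega> - lam1 *\<^sub>R (S *v vln_sq (\<epsilon> (t - 1) \<omega>)) + vln_sq (\<epsilon> t \<omega>)" for t
    unfolding nu_def Y_def Delta_def
    by (rule E.AE_log_square_recursion) (use rad1 in \<open>simp add: S_def\<close>)
  have ma: "AE \<omega> in M. \<nu> t \<omega> = ?\<mu> + E.shock ?A (mat 1) t \<omega> + E.shock ?C ?D (t - 1) \<omega>" for t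
    using res[of t] unfolding Delta_def E.log_square_residual_shocks .
  note moments = E.ma1_moments[of \<nu>, OF meas ma]
  have res': "AE \<omega> in M. \<nu> t \<omega> =
      S *v (\<alpha>1 + \<rho>0 *\<^sub>R (W1 *v egarch_g \<Theta> \<xi> (\<epsilon> t \<omega>)) + \<rho>1 *\<^sub>R egarch_g \<Theta> \<xi> (\<epsilon> (t - 1) \<omega>)
            - lam1 *\<^sub>R vln_sq (\<epsilon> (t - 1) \<omega>)) + vln_sq (\<epsilon> t \<omega>)" for t
    using res[of t] unfolding Delta_def egarch_Delta_def
    by (simp add: matrix_vector_mult_diff_distrib matrix_vector_mult_scaleR)
  \<comment> \<open>With unit row sums the all-ones vector is an eigenvector of \<open>W2\<close>,
    hence of \<open>S\<close> with eigenvalue 1 / (1 - lam0).\<close>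
  have row: "?\<mu> = S *v \<alpha>1 + ((- ln 2 - euler_mascheroni) * (1 - lam1 / (1 - lam0))) *\<^sub>R (\<chi> i. 1)"
    if rows: "\<forall>i. (\<Sum>j\<in>UNIV. W2 $ i $ j) = 1"
  proof -
    let ?one = "(\<chi> i. 1) :: real^'n"
    have "W2 *v ?one = ?one" using rows by (simp add: matrix_vector_mult_def vec_eq_iff)
    then have "(mat 1 - lam0 *\<^sub>R W2) *v ?one = (1 - lam0) *\<^sub>R ?one"
      by (simp add: matrix_vector_mult_diff_rdistrib scaleR_matrix_vector_assoc[symmetric] scaleR_diff_left)
    then have "S *v ((mat 1 - lam0 *\<^sub>R W2) *v ?one) = (1 - lam0) *\<^sub>R (S *v ?one)"
      by (simp add: matrix_vector_mult_scaleR)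
    moreover have "S ** (mat 1 - lam0 *\<^sub>R W2) = mat 1"
      unfolding S_def matrix_inv_def using someI_ex[OF inv[unfolded invertible_def]] by blast
    ultimately have one: "?one = (1 - lam0) *\<^sub>R (S *v ?one)"
      by (simp add: matrix_vector_mul_assoc)
    \<comment> \<open>Otherwise \<open>one\<close> would make the all-ones vector zero.\<close>
    have "lam0 \<noteq> 1"
    proof
      assume "lam0 = 1"
      then have "?one = 0" using one by simp
      then show False by (simp add: vec_eq_iff)
    qed
    then have "S *v ?one = (1 / (1 - lam0)) *\<^sub>R ?one"
      using arg_cong[OF one, of "\<lambda>x. (1 / (1 - lam0)) *\<^sub>R x"] by simp
    then have "(mat 1 - lam1 *\<^sub>R S) *v ?one = (1 - lam1 / (1 - lam0)) *\<^sub>R ?one"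
      by (simp add: matrix_vector_mult_diff_rdistrib scaleR_matrix_vector_assoc[symmetric] scaleR_diff_left)
    then show ?thesis by simp
  qed
  note mat_simps = E.shock_cov_def cg kp scaled_matrix_mult transpose_scaleR matrix_transpose_mul
    transpose_mat matrix_mul_assoc
  have cov0: "E.shock_cov ?A (mat 1) ?A (mat 1) + E.shock_cov ?C ?D ?C ?D =
      (\<rho>0\<^sup>2 * c_g) *\<^sub>R (S ** W1 ** transpose W1 ** transpose S)
      + (pi\<^sup>2 / 2) *\<^sub>R mat 1
      + (\<rho>0 * \<kappa>) *\<^sub>R (S ** W1 + transpose W1 ** transpose S)
      + (\<rho>1\<^sup>2 * c_g + lam1\<^sup>2 * (pi\<^sup>2 / 2) - 2 * \<rho>1 * lam1 * \<kappa>) *\<^sub>R (S ** transpose S)"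
    unfolding mat_simps by (simp add: vec_eq_iff power2_eq_square algebra_simps)
  \<comment> \<open>The shared shock is the one at time t - 1: lagged in the first residual, current
    in the second. The two news weights of the second residual are transposed, hence
    \<open>transpose W1 ** transpose S\<close>.\<close>
  have cov1: "E.shock_cov ?C ?D ?A (mat 1) =
      (\<rho>0 * \<rho>1 * c_g - lam1 * \<rho>0 * \<kappa>) *\<^sub>R (S ** transpose W1 ** transpose S)
      + (\<rho>1 * \<kappa> - lam1 * (pi\<^sup>2 / 2)) *\<^sub>R S"
    unfolding mat_simps by (simp add: vec_eq_iff algebra_simps)
  show ?thesis
    using res res' moments row cov0 cov1 by (auto simp: nu_def)
qed

end
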